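(* If $\mathcal{A}$ is an arrangement of lines in $\mathbb{CP}^2$ such that $\pi_1(M(\mathcal{A}))$ is isomorphic to a direct sum of free groups, then $\mathcal{A}$ is a nice arrangement.
   Context: An arrangement of lines in $\mathbb{CP}^2$ is a finite nonempty set $\mathcal{A}=\{H_0,\dots,H_n\}$ of distinct complex projective lines. Its complement is $M(\mathcal{A})=\mathbb{CP}^2\setminus\bigcup_{i=0}^n H_i$. "Direct sum of free groups" means a finite direct sum (i.e. direct product) of groups $\mathbb{F}_m$, where $\mathbb{F}_m$ is the free group on $m$ generators (so $\mathbb{F}_1=\mathbb{Z}$). Nice arrangements (Jiang--Yau). Define a graph $JY=JY(\mathcal{A})$: its vertex set $VJY$ is the set of points of $\mathbb{CP}^2$ of multiplicity at least three in $\mathcal{A}$ (i.e. lying on at least three lines of $\mathcal{A}$); its edge set $EJY$ consists of one edge $(v,w)$ for every pair of distinct vertices $v,w$ such that the line spanned by $v$ and $w$ belongs to $\mathcal{A}$. A reduced path is an $n$-tuple $(v_1,\dots,v_n)$ of vertices such that each $(v_i,v_{i+1})$ is an edge of the graph and $v_i,v_{i+1},v_{i+2}$ are not on the same line for $i=1,\dots,n-2$. A reduced circle is a reduced path (with $n\ge 2$) such that $v_1=v_n$ and the tuple remains a reduced path upon any cyclic re-indexing. The same notions apply to subgraphs of $JY$, using only the vertices and edges of the subgraph. For $v_0\in VJY$, the star $St(v_0)$ is the subgraph of $JY$ with vertices $VSt(v_0)=\{v_0\}\cup\{v\in VJY : (v,v_0)\in EJY\}$ and edges $ESt(v_0)=\{(v,w)\in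 EJY : v=v_0 \text{ or } w=v_0, \text{ or } v,w,v_0 \text{ span the same line in } \mathcal{A}\}$. The arrangement $\mathcal{A}$ is nice if there exist $v_1,\dots,v_n\in VJY$ (possibly none, $n=0$) such that $St(v_1),\dots,St(v_n)$ are pairwise disjoint in $JY$ and the graph $JY'=JY-\bigcup_{i=1}^n\big(ESt(v_i)\cup\{v_i\}\big)$ contains no reduced circles. *)

theory Defs
  imports "HOL-Analysis.Analysis" "HOL-Algebra.Product_Groups"
begin

section \<open>The complex projective plane\<close>

quotient_type cp2 = "complex ^ 3" / partial:
  "\<lambda>v w. v \<noteq> 0 \<and> w \<noteq> 0 \<and> (\<exists>c. c \<noteq> 0 \<and> w = c *s v)"
proof (rule part_equivpI)
  show "\<exists>v :: complex ^ 3. v \<noteq> 0 \<and> v \<noteq> 0 \<and> (\<exists>c. c \<noteq> 0 \<and> v = c *s v)"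
    by (intro exI [of _ 1] conjI) (auto simp: vec_eq_iff)
  show "symp (\<lambda>v w :: complex ^ 3. v \<noteq> 0 \<and> w \<noteq> 0 \<and> (\<exists>c. c \<noteq> 0 \<and> w = c *s v))"
  proof (rule sympI, clarify)
    fix v :: "complex ^ 3" and c :: complex
    assume "c \<noteq> 0"
    then show "\<exists>d. d \<noteq> 0 \<and> v = d *s (c *s v)"
      by (intro exI [of _ "inverse c"]) (simp add: vector_smult_assoc)
  qed
  show "transp (\<lambda>v w :: complex ^ 3. v \<noteq> 0 \<and> w \<noteq> 0 \<and> (\<exists>c. c \<noteq> 0 \<and> w = c *s v))"
  proof (rule transpI, clarify)
    fix v :: "complex ^ 3" and c d :: complex
    assume "c \<noteq> 0" "d \<noteq> 0"
    then show "\<exists>e. e \<noteq> 0 \<and> d *s (c *s v) = e *s v"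
      by (intro exI [of _ "d * c"]) (simp add: vector_smult_assoc)
  qed
qed

text \<open>For \<open>v \<noteq> 0\<close>, \<open>abs_cp2 v\<close> is the point with homogeneous coordinates \<open>v\<close>; its value at \<open>0\<close>
  is unspecified. The topology is the quotient topology of the nonzero vectors.\<close>

instantiation cp2 :: topological_space
begin

definition open_cp2 :: "cp2 set \<Rightarrow> bool"
  where "open_cp2 U \<longleftrightarrow> open {v. v \<noteq> 0 \<and> abs_cp2 v \<in> U}"

instance
proof
  have "{v :: complex ^ 3. v \<noteq> 0 \<and> abs_cp2 v \<in> UNIV} = - {0}"
    by auto
  then show "open (UNIV :: cp2 set)"
    unfolding open_cp2_def using open_Compl [OF closed_singleton] by simp
next
  fix S T :: "cp2 set"
  assume "open S" "open T"
  moreover have "{v. v \<noteq> 0 \<and> abs_cp2 v \<in> S \<inter> T} =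
      {v. v \<noteq> 0 \<and> abs_cp2 v \<in> S} \<inter> {v. v \<noteq> 0 \<and> abs_cp2 v \<in> T}"
    by auto
  ultimately show "open (S \<inter> T)"
    unfolding open_cp2_def by (simp only: open_Int)
next
  fix K :: "cp2 set set"
  assume "\<forall>S\<in>K. open S"
  moreover have "{v. v \<noteq> 0 \<and> abs_cp2 v \<in> \<Union>K} = (\<Union>S\<in>K. {v. v \<noteq> 0 \<and> abs_cp2 v \<in> S})"
    by auto
  ultimately show "open (\<Union>K)"
    unfolding open_cp2_def by (simp only: open_UN)
qed

end

definition is_line :: "cp2 set \<Rightarrow> bool"
  where "is_line H \<longleftrightarrow>
    (\<exists>a :: complex ^ 3. a \<noteq> 0 \<and> H = abs_cp2 ` {v. v \<noteq> 0 \<and> (\<Sum>i\<in>UNIV. a $ i * v $ i) = 0})"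

text \<open>The projective subspace spanned by a set of points.\<close>

definition proj_span :: "cp2 set \<Rightarrow> cp2 set"
  where "proj_span P = abs_cp2 ` (vec.span {v. v \<noteq> 0 \<and> abs_cp2 v \<in> P} - {0})"

definition line_arrangement :: "cp2 set set \<Rightarrow> bool"
  where "line_arrangement A \<longleftrightarrow> finite A \<and> A \<noteq> {} \<and> (\<forall>H\<in>A. is_line H)"

definition arr_complement :: "cp2 set set \<Rightarrow> cp2 set"
  where "arr_complement A = UNIV - \<Union>A"


section \<open>The fundamental group\<close>

definition loops_at :: "'a::topological_space set \<Rightarrow> 'a \<Rightarrow> (real \<Rightarrow> 'a) set"
  where "loops_at S x = {p. path p \<and> path_image p \<subseteq> S \<and> pathstart p = x \<and> pathfinish p = x}"

definition path_class :: "'a::topological_space set \<Rightarrow> (real \<Rightarrow> 'a) \<Rightarrow> (real \<Rightarrow> 'a) set"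
  where "path_class S p = {q. homotopic_paths S p q}"

definition fundamental_group ::
    "'a::topological_space set \<Rightarrow> 'a \<Rightarrow> (real \<Rightarrow> 'a) set monoid"
  where "fundamental_group S x =
    \<lparr>carrier = path_class S ` loops_at S x,
     monoid.mult = (\<lambda>X Y. \<Union>p\<in>X. \<Union>q\<in>Y. path_class S (p +++ q)),
     one = path_class S (\<lambda>_. x)\<rparr>"

text \<open>The product, written as a union over all representatives, is the class of the
  concatenation of any two of them.\<close>

lemma path_class_eq:
  assumes "homotopic_paths S p q"
  shows "path_class S p = path_class S q"
  unfolding path_class_def
proof (rule Collect_cong, rule iffI)
  fix r
  show "homotopic_paths S q r" if "homotopic_paths S p r"
    by (rule homotopic_paths_trans [OF homotopic_paths_sym [OF assms] that])
  show "homotopic_paths S p r" if "homotopic_paths S q r"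
    by (rule homotopic_paths_trans [OF assms that])
qed

lemma fundamental_group_mult:
  assumes "p \<in> loops_at S x" "q \<in> loops_at S x"
  shows "path_class S p \<otimes>\<^bsub>fundamental_group S x\<^esub> path_class S q = path_class S (p +++ q)"
proof -
  have eq: "path_class S (p' +++ q') = path_class S (p +++ q)"
    if "p' \<in> path_class S p" "q' \<in> path_class S q" for p' q'
  proof -
    have "homotopic_paths S p p'" "homotopic_paths S q q'"
      using that by (simp_all add: path_class_def)
    moreover have "pathfinish p = pathstart q"
      using assms by (simp add: loops_at_def)
    ultimately have "homotopic_paths S (p +++ q) (p' +++ q')"
      by (rule homotopic_paths_join)
    then show ?thesis
      by (rule path_class_eq [symmetric])
  qed
  have ne: "p \<in> path_class S p" "q \<in> path_class S q"
    using assms by (simp_all add: path_class_def loops_at_def)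
  have "(\<Union>p'\<in>path_class S p. \<Union>q'\<in>path_class S q. path_class S (p' +++ q')) =
      (\<Union>p'\<in>path_class S p. \<Union>q'\<in>path_class S q. path_class S (p +++ q))"
    by (simp only: eq cong: SUP_cong)
  then show ?thesis
    using ne by (auto simp: fundamental_group_def)
qed


section \<open>Free groups of finite rank\<close>

text \<open>The letter \<open>(i, True)\<close> stands for the generator \<open>x\<^sub>i\<close> and \<open>(i, False)\<close> for its inverse. The
  elements of the free group are the reduced words.\<close>

type_synonym letter = "nat \<times> bool"

definition inv_letter :: "letter \<Rightarrow> letter"
  where "inv_letter a = (fst a, \<not> snd a)"

definition reduced_word :: "letter list \<Rightarrow> bool"
  where "reduced_word = successively (\<lambda>a b. b \<noteq> inv_letter a)"

fun cons_cancel :: "letter \<Rightarrow> letter list \<Rightarrow> letter list" where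
  "cons_cancel a [] = [a]"
| "cons_cancel a (b # w) = (if b = inv_letter a then w else a # b # w)"

definition free_group :: "nat \<Rightarrow> letter list monoid"
  where "free_group m =
    \<lparr>carrier = {w. set w \<subseteq> {..<m} \<times> UNIV \<and> reduced_word w},
     monoid.mult = (\<lambda>u w. foldr cons_cancel u w),
     one = []\<rparr>"


section \<open>The Jiang-Yau graph and nice arrangements\<close>

text \<open>Undirected graphs are represented by symmetric sets of ordered pairs.\<close>

record 'v graph =
  vertices :: "'v set"
  edges :: "('v \<times> 'v) set"

definition VJY :: "cp2 set set \<Rightarrow> cp2 set"
  where "VJY A = {p. card {H \<in> A. p \<in> H} \<ge> 3}"

definition EJY :: "cp2 set set \<Rightarrow> (cp2 \<times> cp2) set"
  where "EJY A = {(v, w). v \<in> VJY A \<and> w \<in> VJY A \<and> v \<noteq> w \<and> proj_span {v, w} \<in> A}"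

definition star :: "cp2 set set \<Rightarrow> cp2 \<Rightarrow> cp2 graph"
  where "star A v\<^sub>0 =
    \<lparr>vertices = {v\<^sub>0} \<union> {v \<in> VJY A. (v, v\<^sub>0) \<in> EJY A},
     edges = {(v, w) \<in> EJY A. v = v\<^sub>0 \<or> w = v\<^sub>0 \<or> proj_span {v, w, v\<^sub>0} \<in> A}\<rparr>"

definition on_common_line :: "cp2 set \<Rightarrow> bool"
  where "on_common_line P \<longleftrightarrow> (\<exists>H. is_line H \<and> P \<subseteq> H)"

definition reduced_path :: "cp2 graph \<Rightarrow> cp2 list \<Rightarrow> bool"
  where "reduced_path G vs \<longleftrightarrow>
    set vs \<subseteq> vertices G \<and>
    (\<forall>i. i + 1 < length vs \<longrightarrow> (vs ! i, vs ! (i + 1)) \<in> edges G) \<and>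
    (\<forall>i. i + 2 < length vs \<longrightarrow> \<not> on_common_line {vs ! i, vs ! (i + 1), vs ! (i + 2)})"

text \<open>A closed tuple \<open>(v\<^sub>1, \<dots>, v\<^sub>n)\<close> with \<open>v\<^sub>1 = v\<^sub>n\<close> has the cyclic re-indexings
  \<open>(v\<^sub>k, \<dots>, v\<^bsub>n-1\<^esub>, v\<^sub>1, \<dots>, v\<^sub>k)\<close>: the cycle \<open>(v\<^sub>1, \<dots>, v\<^bsub>n-1\<^esub>)\<close> is rotated, and then closed
  up again by repeating its new first vertex.\<close>

definition cyclic_reindex :: "nat \<Rightarrow> 'v list \<Rightarrow> 'v list"
  where "cyclic_reindex k vs = (let c = rotate k (butlast vs) in c @ [hd c])"

definition reduced_circle :: "cp2 graph \<Rightarrow> cp2 list \<Rightarrow> bool"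
  where "reduced_circle G vs \<longleftrightarrow>
    length vs \<ge> 2 \<and> reduced_path G vs \<and> hd vs = last vs \<and>
    (\<forall>k. reduced_path G (cyclic_reindex k vs))"

definition disjoint_graphs :: "'v graph \<Rightarrow> 'v graph \<Rightarrow> bool"
  where "disjoint_graphs G H \<longleftrightarrow>
    vertices G \<inter> vertices H = {} \<and> edges G \<inter> edges H = {}"

definition JY_minus_stars :: "cp2 set set \<Rightarrow> cp2 list \<Rightarrow> cp2 graph"
  where "JY_minus_stars A vs =
    \<lparr>vertices = VJY A - set vs,
     edges = EJY A - (\<Union>v\<in>set vs. edges (star A v))\<rparr>"

definition nice_arrangement :: "cp2 set set \<Rightarrow> bool"
  where "nice_arrangement A \<longleftrightarrow>
    (\<exists>vs. set vs \<subseteq> VJY A \<and>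
      (\<forall>i<length vs. \<forall>j<length vs. i \<noteq> j \<longrightarrow> disjoint_graphs (star A (vs ! i)) (star A (vs ! j))) \<and>
      (\<nexists>cs. reduced_circle (JY_minus_stars A vs) cs))"

end

theory Submission
  imports Defs "HOL-Complex_Analysis.Riemann_Mapping"
begin

text \<open>For lines \<open>H\<close>, \<open>K\<close> of the arrangement, the winding number of the quotient of their equations
  is a homomorphism \<open>w\<^bsub>HK\<^esub>\<close> from the fundamental group to the integers. If \<open>H\<close>, \<open>K\<close>, \<open>L\<close> pass through one
  point, the pair \<open>(w\<^bsub>KH\<^esub>, w\<^bsub>LH\<^esub>)\<close> factors through the fundamental group of \<open>\<complex> - {0, 1}\<close>, so it has
  determinant zero on commuting pairs. In a product of free groups this forces all \<open>w\<^bsub>HK\<^esub>\<close> with \<open>H\<close>, \<open>K\<close>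
  through a given point of multiplicity at least three to be supported on a single factor, and the
  tori around the intersection points show that distinct such points have distinct factors. The
  homomorphisms belonging to distinct points are therefore linearly independent. But along a
  closed path \<open>p\<^sub>0, p\<^sub>1, \<dots>\<close> in the graph with edges on the lines \<open>L\<^sub>0, L\<^sub>1, \<dots>\<close> the homomorphisms
  \<open>w\<close> of \<open>(L\<^sub>m, L\<^bsub>m-1\<^esub>)\<close>, each of which belongs to \<open>p\<^sub>m\<close>, add up to zero. So the graph itself has no
  reduced circle, and no star has to be removed.\<close>

section \<open>Additive functions on products of free groups\<close>

text \<open>The equation of a line is not a function on the projective plane, but the quotient of
  two equations is; this is why the homomorphisms are indexed by pairs of lines. Three lines through
  one point have linearly dependent equations, so after rescaling two of the quotients by constants
  they become \<open>F\<close> and \<open>F - 1\<close>, and \<open>F\<close> omits 0 and 1. The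
  isomorphism is only known to exist, so it does not say in which factor a given loop lives. The
  vanishing determinant is what locates the factors: elements of different factors always commute,
  hence a pair of homomorphisms whose determinant vanishes on commuting elements cannot have its
  two-dimensional image spread over two factors. That the determinant vanishes on commuting loops in
  the plane without 0 and 1 is proved by lifting along \<open>exp\<close>, without computing the
  fundamental group of that space.\<close>

definition additive_on :: "('g, 'b) monoid_scheme \<Rightarrow> ('g \<Rightarrow> complex) \<Rightarrow> bool"
  where "additive_on G a \<longleftrightarrow>
    (\<forall>x\<in>carrier G. \<forall>y\<in>carrier G. a (x \<otimes>\<^bsub>G\<^esub> y) = a x + a y)"

lemma additive_onD:
  "additive_on G a \<Longrightarrow> x \<in> carrier G \<Longrightarrow> y \<in> carrier G \<Longrightarrow> a (x \<otimes>\<^bsub>G\<^esub> y) = a x + a y"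
  by (simp add: additive_on_def)

definition letter_value :: "(nat \<Rightarrow> complex) \<Rightarrow> letter \<Rightarrow> complex"
  where "letter_value c l = (if snd l then c (fst l) else - c (fst l))"

definition word_value :: "(nat \<Rightarrow> complex) \<Rightarrow> letter list \<Rightarrow> complex"
  where "word_value c w = (\<Sum>l\<leftarrow>w. letter_value c l)"

lemma word_value_simps [simp]:
  "word_value c [] = 0"
  "word_value c (l # w) = letter_value c l + word_value c w"
  by (simp_all add: word_value_def)

lemma letter_value_inv [simp]: "letter_value c (inv_letter l) = - letter_value c l"
  by (simp add: letter_value_def inv_letter_def)

lemma word_value_cons_cancel [simp]:
  "word_value c (cons_cancel l w) = letter_value c l + word_value c w"
  by (induction l w rule: cons_cancel.induct) auto

lemma word_value_mult:
  "word_value c (foldr cons_cancel u w) = word_value c u + word_value c w"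
  by (induction u) auto

text \<open>The central coordinate of the homomorphism from the free group to the Heisenberg group
  whose other two coordinates are the values for \<open>c\<close> and \<open>d\<close>.\<close>

fun heis_value :: "(nat \<Rightarrow> complex) \<Rightarrow> (nat \<Rightarrow> complex) \<Rightarrow> letter list \<Rightarrow> complex" where
  "heis_value c d [] = 0"
| "heis_value c d (l # w) =
    heis_value c d w + letter_value c l * word_value d w - letter_value d l * word_value c w"

text \<open>The antisymmetric form gives a letter followed by its inverse the central coordinate 0,
  so deleting such a pair changes nothing. The form with the first product alone would leave a
  correction term.\<close>

lemma heis_value_cons_cancel:
  "heis_value c d (cons_cancel l w) =
    heis_value c d w + letter_value c l * word_value d w - letter_value d l * word_value c w"
  by (induction l w rule: cons_cancel.induct) (auto simp: algebra_simps)

lemma heis_value_mult: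
  "heis_value c d (foldr cons_cancel u w) =
    heis_value c d u + heis_value c d w + word_value c u * word_value d w - word_value d u * word_value c w"
  by (induction u) (auto simp: heis_value_cons_cancel word_value_mult algebra_simps)

lemma reduced_word_Cons: "reduced_word (l # w) \<longleftrightarrow> reduced_word w \<and> cons_cancel l w = l # w"
  by (cases w) (auto simp: reduced_word_def)

lemma free_group_r_one:
  assumes "reduced_word w"
  shows "foldr cons_cancel w [] = w"
  using assms by (induction w) (auto simp: reduced_word_Cons)

text \<open>Brings an arbitrary additive function into the form to which \<open>heis_value\<close>
  applies, which is built from values on the generators.\<close>

lemma free_group_additive_word_value:
  assumes a: "additive_on (free_group m) a" and w: "w \<in> carrier (free_group m)"
  shows "a w = word_value (\<lambda>i. a [(i, True)]) w"
proof -
  have nil: "[] \<in> carrier (free_group m)"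
    by (simp add: free_group_def reduced_word_def)
  have sing: "[l] \<in> carrier (free_group m)" if "fst l < m" for l
    using that by (cases l) (auto simp: free_group_def reduced_word_def)
  have a0: "a [] = 0"
    using additive_onD [OF a nil nil] by (simp add: free_group_def)
  have letter: "a [l] = letter_value (\<lambda>i. a [(i, True)]) l" if "fst l < m" for l
  proof (cases l)
    case (Pair i s)
    have "a ([(i, True)] \<otimes>\<^bsub>free_group m\<^esub> [(i, False)]) = a [(i, True)] + a [(i, False)]"
      using that Pair by (intro additive_onD [OF a] sing) auto
    then have "a [(i, False)] = - a [(i, True)]"
      by (simp add: free_group_def inv_letter_def a0 eq_neg_iff_add_eq_0 add.commute)
    then show ?thesis
      by (cases s) (auto simp: Pair letter_value_def)
  qed
  show ?thesis
    using w
  proof (induction w)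
    case Nil
    then show ?case by (simp add: a0)
  next
    case (Cons l w)
    have w: "w \<in> carrier (free_group m)" and l: "fst l < m" and red: "cons_cancel l w = l # w"
      using Cons.prems by (auto simp: free_group_def reduced_word_Cons)
    have "a ([l] \<otimes>\<^bsub>free_group m\<^esub> w) = a [l] + a w"
      by (intro additive_onD [OF a] sing w l)
    then show ?case
      using Cons.IH [OF w] letter [OF l] red by (simp add: free_group_def)
  qed
qed

text \<open>Commuting elements have commuting images in the Heisenberg group.\<close>

lemma free_group_commuting_det:
  assumes a: "additive_on (free_group m) a" and b: "additive_on (free_group m) b"
    and x: "x \<in> carrier (free_group m)" and y: "y \<in> carrier (free_group m)"
    and comm: "x \<otimes>\<^bsub>free_group m\<^esub> y = y \<otimes>\<^bsub>free_group m\<^esub> x"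
  shows "a x * b y = a y * b x"
proof -
  let ?c = "\<lambda>i. a [(i, True)]" and ?d = "\<lambda>i. b [(i, True)]"
  have "heis_value ?c ?d (foldr cons_cancel x y) = heis_value ?c ?d (foldr cons_cancel y x)"
    using comm by (simp add: free_group_def)
  then have "2 * (word_value ?c x * word_value ?d y) = 2 * (word_value ?c y * word_value ?d x)"
    by (simp add: heis_value_mult algebra_simps)
  then show ?thesis
    by (simp add: free_group_additive_word_value [OF a] free_group_additive_word_value [OF b] x y)
qed

section \<open>Restriction of additive functions to the factors of a product\<close>

lemma free_group_one_mult:
  assumes "w \<in> carrier (free_group m)"
  shows "[] \<otimes>\<^bsub>free_group m\<^esub> w = w" "w \<otimes>\<^bsub>free_group m\<^esub> [] = w" 
  using assms free_group_r_one by (auto simp: free_group_def)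

abbreviation free_product :: "nat \<Rightarrow> (nat \<Rightarrow> nat) \<Rightarrow> (nat \<Rightarrow> letter list) monoid"
  where "free_product k r \<equiv> product_group {..<k} (\<lambda>i. free_group (r i))"

definition factor_inj :: "nat \<Rightarrow> nat \<Rightarrow> letter list \<Rightarrow> nat \<Rightarrow> letter list"
  where "factor_inj k i w = (\<lambda>j\<in>{..<k}. if j = i then w else [])"

lemma nil_in_free_group [simp]: "[] \<in> carrier (free_group m)"
  by (simp add: free_group_def reduced_word_def)

lemma factor_inj_carrier:
  assumes "w \<in> carrier (free_group (r i))"
  shows "factor_inj k i w \<in> carrier (free_product k r)"
  using assms by (auto simp: factor_inj_def)

lemma factor_inj_mult:
  "factor_inj k i (u \<otimes>\<^bsub>free_group (r i)\<^esub> w) =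
    factor_inj k i u \<otimes>\<^bsub>free_product k r\<^esub> factor_inj k i w"
  by (auto simp: factor_inj_def free_group_one_mult)

lemma factor_inj_commute:
  assumes "i \<noteq> j" "u \<in> carrier (free_group (r i))" "w \<in> carrier (free_group (r j))"
  shows "factor_inj k i u \<otimes>\<^bsub>free_product k r\<^esub> factor_inj k j w =
    factor_inj k j w \<otimes>\<^bsub>free_product k r\<^esub> factor_inj k i u"
  using assms by (auto simp: factor_inj_def free_group_one_mult)

lemma additive_on_factor:
  assumes "additive_on (free_product k r) a"
  shows "additive_on (free_group (r i)) (\<lambda>w. a (factor_inj k i w))"
  unfolding additive_on_def factor_inj_mult [where r = r]
  by (intro ballI additive_onD [OF assms] factor_inj_carrier)

text \<open>An element of a finite product is assembled by inserting its coordinates one at a time;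
  \<open>trunc n\<close> has received the first \<open>n\<close> of them.\<close>

lemma additive_on_sum_factors:
  assumes a: "additive_on (free_product k r) a" and x: "x \<in> carrier (free_product k r)"
  shows "a x = (\<Sum>i<k. a (factor_inj k i (x i)))"
proof -
  define trunc where "trunc n = (\<lambda>j\<in>{..<k}. if j < n then x j else [])" for n
  have xi: "x i \<in> carrier (free_group (r i))" if "i < k" for i
    using x that by auto
  have tr: "trunc n \<in> carrier (free_product k r)" for n
    using xi by (auto simp: trunc_def)
  have "a (trunc n) = (\<Sum>i<n. a (factor_inj k i (x i)))" if "n \<le> k" for n
    using that
  proof (induction n)
    case 0
    \<comment> \<open>An additive function is 0 on an idempotent.\<close>
    have "trunc 0 \<otimes>\<^bsub>free_product k r\<^esub> trunc 0 = trunc 0"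
      by (auto simp: trunc_def free_group_one_mult)
    then show ?case
      using additive_onD [OF a tr tr, of 0 0] by simp
  next
    case (Suc n)
    have "trunc (Suc n) = trunc n \<otimes>\<^bsub>free_product k r\<^esub> factor_inj k n (x n)"
      using xi by (auto simp: trunc_def factor_inj_def free_group_one_mult fun_eq_iff less_Suc_eq)
    then show ?case
      using Suc additive_onD [OF a tr factor_inj_carrier [where i = n, OF xi], of n] by (simp only: sum.lessThan_Suc)
  qed
  moreover have "trunc k = x"
  proof
    fix j
    show "trunc k j = x j"
      using x by (cases "j < k") (auto simp: trunc_def PiE_iff extensional_def)
  qed
  ultimately show ?thesis by auto
qed

text \<open>An index \<open>i \<ge> k\<close> is allowed and then means vanishing on every factor.
  An additive function that vanishes identically is supported on every index, so uniqueness of the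
  index requires a nonzero value.\<close>

definition supported_on :: "nat \<Rightarrow> (nat \<Rightarrow> nat) \<Rightarrow> nat \<Rightarrow> ((nat \<Rightarrow> letter list) \<Rightarrow> complex) \<Rightarrow> bool"
  where "supported_on k r i a \<longleftrightarrow>
    (\<forall>j<k. j \<noteq> i \<longrightarrow> (\<forall>w\<in>carrier (free_group (r j)). a (factor_inj k j w) = 0))"

lemma supported_on_eval:
  assumes a: "additive_on (free_product k r) a" "supported_on k r i a"
    and x: "x \<in> carrier (free_product k r)"
  shows "a x = (if i < k then a (factor_inj k i (x i)) else 0)"
proof -
  have "a x = (\<Sum>j<k. a (factor_inj k j (x j)))"
    by (rule additive_on_sum_factors [OF a(1) x])
  also have "\<dots> = (\<Sum>j<k. if j = i then a (factor_inj k j (x j)) else 0)"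
    using a(2) x unfolding supported_on_def by (intro sum.cong) auto
  finally show ?thesis
    by simp
qed

lemma supported_on_unique:
  assumes a: "additive_on (free_product k r) a" "supported_on k r i a" "supported_on k r j a"
    and x: "x \<in> carrier (free_product k r)" "a x \<noteq> 0"
  shows "i = j"
proof (rule ccontr)
  assume "i \<noteq> j"
  moreover have "x l \<in> carrier (free_group (r l))" if "l < k" for l
    using x(1) that by auto
  ultimately have "a (factor_inj k l (x l)) = 0" if "l < k" for l
    using a(2,3) that unfolding supported_on_def by metis
  then show False
    using additive_on_sum_factors [OF a(1) x(1)] x(2) by simp
qed

text \<open>Both functions see only the \<open>i\<close>-th coordinate, and the coordinates of
  commuting elements commute, which leaves the determinant identity of a single free group.\<close>

lemma supported_on_det:
  assumes a: "additive_on (free_product k r) a" "supported_on k r i a"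
    and b: "additive_on (free_product k r) b" "supported_on k r i b"
    and x: "x \<in> carrier (free_product k r)" and y: "y \<in> carrier (free_product k r)"
    and comm: "x \<otimes>\<^bsub>free_product k r\<^esub> y = y \<otimes>\<^bsub>free_product k r\<^esub> x"
  shows "a x * b y = a y * b x"
proof (cases "i < k")
  case True
  have "(x \<otimes>\<^bsub>free_product k r\<^esub> y) i = (y \<otimes>\<^bsub>free_product k r\<^esub> x) i"
    by (simp only: comm)
  then have "x i \<otimes>\<^bsub>free_group (r i)\<^esub> y i = y i \<otimes>\<^bsub>free_group (r i)\<^esub> x i"
    using True by simp
  then have "a (factor_inj k i (x i)) * b (factor_inj k i (y i)) =
      a (factor_inj k i (y i)) * b (factor_inj k i (x i))"
    using x y True
    by (intro free_group_commuting_det [OF additive_on_factor [OF a(1)] additive_on_factor [OF b(1)]]) auto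
  then show ?thesis
    using True by (simp add: supported_on_eval [OF a x] supported_on_eval [OF a y]
        supported_on_eval [OF b x] supported_on_eval [OF b y])
next
  case False
  then show ?thesis
    by (simp add: supported_on_eval [OF a x] supported_on_eval [OF a y]
        supported_on_eval [OF b x] supported_on_eval [OF b y])
qed

text \<open>Proportionality of plane vectors, written as a cross product, is transitive through a
  nonzero middle vector, here \<open>(e, f)\<close>.\<close>

lemma parallel_trans:
  fixes a b c d e f :: "'a::idom"
  assumes "a * f = e * b" "c * f = e * d" "e \<noteq> 0 \<or> f \<noteq> 0"
  shows "a * d = c * b"
proof -
  have "e * (a * d) = a * (c * f)"
    by (simp add: assms(2) ac_simps)
  also have "\<dots> = e * (c * b)"
    using assms(1) by (simp add: ac_simps)
  finally have e: "e * (a * d) = e * (c * b)" .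
  have "f * (a * d) = (a * f) * d"
    by (simp add: ac_simps)
  also have "\<dots> = f * (c * b)"
    using assms by (simp add: ac_simps)
  finally have "f * (a * d) = f * (c * b)" .
  with e show ?thesis
    using assms(3) by auto
qed

text \<open>If two factors had nonzero images under \<open>(a, b)\<close>, the images of all factors would lie on
  one line.\<close>

lemma commuting_det_imp_supported:
  assumes a: "additive_on (free_product k r) a" and b: "additive_on (free_product k r) b"
    and det: "\<And>x y. x \<in> carrier (free_product k r) \<Longrightarrow> y \<in> carrier (free_product k r) \<Longrightarrow>
        x \<otimes>\<^bsub>free_product k r\<^esub> y = y \<otimes>\<^bsub>free_product k r\<^esub> x \<Longrightarrow> a x * b y = a y * b x"
    and indep: "x \<in> carrier (free_product k r)" "y \<in> carrier (free_product k r)"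
        "a x * b y \<noteq> a y * b x"
  shows "\<exists>i. supported_on k r i a \<and> supported_on k r i b"
proof -
  define A where "A j w = a (factor_inj k j w)" for j w
  define B where "B j w = b (factor_inj k j w)" for j w
  let ?F = "\<lambda>j. carrier (free_group (r j))"
  have par: "A i u * B j w = A j w * B i u"
    if "i \<noteq> j" "u \<in> ?F i" "w \<in> ?F j" for i j u w
    unfolding A_def B_def using that by (intro det factor_inj_carrier factor_inj_commute)
  have sum: "a x = (\<Sum>i<k. A i (x i))" "b x = (\<Sum>i<k. B i (x i))"
    if "x \<in> carrier (free_product k r)" for x
    unfolding A_def B_def using that additive_on_sum_factors a b by auto
  have "\<exists>i<k. \<exists>u\<in>?F i. A i u \<noteq> 0 \<or> B i u \<noteq> 0"
  proof (rule ccontr)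
    assume "\<not> ?thesis"
    then have "a x = 0" "b x = 0"
      using indep(1) sum by (auto intro!: sum.neutral)
    then show False
      using indep(3) by simp
  qed
  then obtain i u where i: "i < k" and u: "u \<in> ?F i" "A i u \<noteq> 0 \<or> B i u \<noteq> 0"
    by blast
  have "A j w = 0 \<and> B j w = 0" if j: "j < k" "j \<noteq> i" "w \<in> ?F j" for j w
  proof (rule ccontr)
    assume nz: "\<not> (A j w = 0 \<and> B j w = 0)"
    have uw: "A i u * B j w = A j w * B i u"
      by (rule par) (use j u in auto)
    \<comment> \<open>Vectors from other factors are compared with \<open>(A i u, B i u)\<close>
      directly; those from factor \<open>i\<close> itself take the detour through the nonzero vector
      \<open>(A j w, B j w)\<close> of factor \<open>j\<close>.\<close>
    have line: "A l v * B i u = A i u * B l v" if l: "l < k" "v \<in> ?F l" for l v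
    proof (cases "l = i")
      case False
      then show ?thesis
        using par [of i l u v] l u by (simp add: mult.commute)
    next
      case True
      have "A l v * B j w = A j w * B l v"
        using par [of l j v w] l j True by simp
      with uw nz show ?thesis
        using parallel_trans [of "A l v" "B j w" "A j w" "B l v" "A i u" "B i u"] by auto
    qed
    have "a x * B i u = A i u * b x" if "x \<in> carrier (free_product k r)" for x
      using that line by (auto simp: sum [OF that] sum_distrib_left sum_distrib_right intro!: sum.cong)
    then have "a x * B i u = A i u * b x" "a y * B i u = A i u * b y"
      using indep by auto
    with u(2) indep(3) show False
      using parallel_trans [of "a x" "B i u" "A i u" "b x" "a y" "b y"] by auto
  qed
  then have "supported_on k r i a \<and> supported_on k r i b"
    by (simp add: supported_on_def A_def B_def)
  then show ?thesis ..
qed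

section \<open>The fundamental group\<close>

text \<open>Explicit homotopies are obtained in a convex parameter domain and pushed forward: an
  interval gives the unit and inverse laws, a square gives commuting loops on a torus.\<close>

lemma homotopic_paths_convex_image:
  fixes f :: "'b::real_normed_vector \<Rightarrow> 'a::topological_space"
  assumes "convex C" "continuous_on C f" "f \<in> C \<rightarrow> S"
    and "path u" "path_image u \<subseteq> C" "path v" "path_image v \<subseteq> C"
    and "pathstart u = pathstart v" "pathfinish u = pathfinish v"
  shows "homotopic_paths S (f \<circ> u) (f \<circ> v)"
proof -
  have "homotopic_paths C u v"
    using convex_imp_simply_connected [OF assms(1)] assms(4-)
    unfolding simply_connected_eq_homotopic_paths by metis
  then show ?thesis
    using assms(2,3) by (rule homotopic_paths_continuous_image)
qed

lemma homotopic_paths_reparam: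
  assumes "path p" "path_image p \<subseteq> S"
    and "path u" "path_image u \<subseteq> {0..1}" "path v" "path_image v \<subseteq> {0..1}"
    and "pathstart u = pathstart v" "pathfinish u = pathfinish v"
  shows "homotopic_paths S (p \<circ> u) (p \<circ> v)"
  using assms by (intro homotopic_paths_convex_image [of "{0..1}"]) (auto simp: path_def path_image_def)

lemma comp_linepath_01: "p \<circ> linepath 0 1 = p"
  by (simp add: linepath_def o_def)

lemma path_const: "path (\<lambda>_. x)" "path_image (\<lambda>_. x) = {x}"
    "pathstart (\<lambda>_. x) = x" "pathfinish (\<lambda>_. x) = x"
  by (auto simp: path_def path_image_def pathstart_def pathfinish_def)

lemma homotopic_paths_const_left:
  assumes "path p" "path_image p \<subseteq> S" "pathstart p = x"
  shows "homotopic_paths S ((\<lambda>_. x) +++ p) p"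
proof -
  have "homotopic_paths S (p \<circ> (linepath 0 0 +++ linepath 0 1)) (p \<circ> linepath 0 1)"
    by (rule homotopic_paths_reparam [OF assms(1,2)])
      (auto simp: path_image_join closed_segment_eq_real_ivl)
  moreover have "p \<circ> (linepath 0 0 +++ linepath 0 1) = (\<lambda>_. x) +++ p"
    using assms(3) by (auto simp: joinpaths_def linepath_def pathstart_def)
  ultimately show ?thesis
    by (simp add: comp_linepath_01)
qed

lemma homotopic_paths_reverse_left:
  assumes "path p" "path_image p \<subseteq> S" "pathfinish p = x"
  shows "homotopic_paths S (reversepath p +++ p) (\<lambda>_. x)"
proof -
  have "homotopic_paths S (p \<circ> (linepath 1 0 +++ linepath 0 1)) (p \<circ> linepath 1 1)"
    by (rule homotopic_paths_reparam [OF assms(1,2)])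
      (auto simp: path_image_join closed_segment_eq_real_ivl)
  moreover have "p \<circ> (linepath 1 0 +++ linepath 0 1) = reversepath p +++ p"
    by (auto simp: joinpaths_def linepath_def reversepath_def)
  moreover have "p \<circ> linepath 1 1 = (\<lambda>_. x)"
    using assms(3) by (auto simp: linepath_def pathfinish_def)
  ultimately show ?thesis
    by simp
qed

lemma loops_atD:
  assumes "p \<in> loops_at S x"
  shows "path p" "path_image p \<subseteq> S" "pathstart p = x" "pathfinish p = x"
  using assms by (auto simp: loops_at_def)

lemma loops_at_join: "p \<in> loops_at S x \<Longrightarrow> q \<in> loops_at S x \<Longrightarrow> p +++ q \<in> loops_at S x"
  by (auto simp: loops_at_def path_image_join)

lemma fundamental_group_carrier: "carrier (fundamental_group S x) = path_class S ` loops_at S x"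
  by (simp add: fundamental_group_def)

lemma group_fundamental_group:
  assumes "x \<in> S"
  shows "group (fundamental_group S x)"
proof (rule groupI)
  let ?G = "fundamental_group S x"
  have const: "(\<lambda>_. x) \<in> loops_at S x"
    using assms by (auto simp: loops_at_def path_const)
  have one: "\<one>\<^bsub>?G\<^esub> = path_class S (\<lambda>_. x)"
    by (simp add: fundamental_group_def)
  show "\<one>\<^bsub>?G\<^esub> \<in> carrier ?G"
    using const by (simp add: one fundamental_group_carrier)
  fix X assume "X \<in> carrier ?G"
  then obtain p where X: "X = path_class S p" and p: "p \<in> loops_at S x"
    by (auto simp: fundamental_group_carrier)
  show "\<one>\<^bsub>?G\<^esub> \<otimes>\<^bsub>?G\<^esub> X = X"
    unfolding one X fundamental_group_mult [OF const p]
    by (rule path_class_eq homotopic_paths_const_left loops_atD [OF p])+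
  have rev: "reversepath p \<in> loops_at S x"
    using p by (auto simp: loops_at_def)
  have "path_class S (reversepath p) \<otimes>\<^bsub>?G\<^esub> X = \<one>\<^bsub>?G\<^esub>"
    unfolding one X fundamental_group_mult [OF rev p]
    by (rule path_class_eq homotopic_paths_reverse_left loops_atD [OF p])+
  then show "\<exists>Y\<in>carrier ?G. Y \<otimes>\<^bsub>?G\<^esub> X = \<one>\<^bsub>?G\<^esub>"
    using rev by (auto simp: fundamental_group_carrier)
  fix Y assume "Y \<in> carrier ?G"
  then obtain q where Y: "Y = path_class S q" and q: "q \<in> loops_at S x"
    by (auto simp: fundamental_group_carrier)
  show "X \<otimes>\<^bsub>?G\<^esub> Y \<in> carrier ?G"
    using loops_at_join [OF p q] by (simp add: X Y fundamental_group_mult [OF p q] fundamental_group_carrier)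
  fix Z assume "Z \<in> carrier ?G"
  then obtain r where Z: "Z = path_class S r" and r: "r \<in> loops_at S x"
    by (auto simp: fundamental_group_carrier)
  have "homotopic_paths S (p +++ (q +++ r)) ((p +++ q) +++ r)"
    by (intro homotopic_paths_assoc) (simp_all add: loops_atD [OF p] loops_atD [OF q] loops_atD [OF r])
  then show "X \<otimes>\<^bsub>?G\<^esub> Y \<otimes>\<^bsub>?G\<^esub> Z = X \<otimes>\<^bsub>?G\<^esub> (Y \<otimes>\<^bsub>?G\<^esub> Z)"
    by (simp add: X Y Z fundamental_group_mult p q r loops_at_join path_class_eq)
qed

section \<open>Change of base point\<close>

definition conj_loop :: "(real \<Rightarrow> 'a::topological_space) \<Rightarrow> (real \<Rightarrow> 'a) \<Rightarrow> real \<Rightarrow> 'a"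
  where "conj_loop c p = (c +++ p) +++ reversepath c"

lemma conj_loop_in_loops_at:
  assumes "path c" "path_image c \<subseteq> S" "p \<in> loops_at S (pathfinish c)"
  shows "conj_loop c p \<in> loops_at S (pathstart c)"
  using assms by (auto simp: loops_at_def conj_loop_def path_image_join)

lemma conj_loop_join:
  assumes c: "path c" "path_image c \<subseteq> S"
    and p: "p \<in> loops_at S (pathfinish c)" and q: "q \<in> loops_at S (pathfinish c)"
  shows "homotopic_paths S (conj_loop c p +++ conj_loop c q) (conj_loop c (p +++ q))"
proof -
  let ?r = "reversepath c"
  note [simp] = loops_atD [OF p] loops_atD [OF q] c path_image_join path_const
  have [simp]: "pathfinish c \<in> S"
    using c(2) pathfinish_in_path_image by blast
  note as = homotopic_paths_sym [OF homotopic_paths_assoc]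
  have "homotopic_paths S (conj_loop c p +++ conj_loop c q) ((c +++ p) +++ (?r +++ ((c +++ q) +++ ?r)))"
    unfolding conj_loop_def by (rule as) auto
  also have "homotopic_paths S \<dots> ((c +++ p) +++ (?r +++ (c +++ (q +++ ?r))))"
    by (intro homotopic_paths_join as) auto
  also have "homotopic_paths S \<dots> ((c +++ p) +++ ((?r +++ c) +++ (q +++ ?r)))"
    by (intro homotopic_paths_join homotopic_paths_assoc) auto
  also have "homotopic_paths S \<dots> ((c +++ p) +++ ((\<lambda>_. pathfinish c) +++ (q +++ ?r)))"
    by (intro homotopic_paths_join homotopic_paths_reverse_left) auto
  also have "homotopic_paths S \<dots> ((c +++ p) +++ (q +++ ?r))"
    by (intro homotopic_paths_join homotopic_paths_const_left) auto
  also have "homotopic_paths S \<dots> (((c +++ p) +++ q) +++ ?r)"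
    by (intro homotopic_paths_assoc) auto
  also have "homotopic_paths S \<dots> (conj_loop c (p +++ q))"
    unfolding conj_loop_def by (intro homotopic_paths_join as) auto
  finally show ?thesis .
qed

text \<open>The tori used later lie near a point of the arrangement, away from the fixed base point.
  Conjugation by a connecting path is multiplicative up to homotopy, so it carries commuting loops
  to commuting loops.\<close>

lemma conj_loop_commute:
  assumes c: "path c" "path_image c \<subseteq> S"
    and p: "p \<in> loops_at S (pathfinish c)" and q: "q \<in> loops_at S (pathfinish c)"
    and pq: "homotopic_paths S (p +++ q) (q +++ p)"
  shows "path_class S (conj_loop c p) \<otimes>\<^bsub>fundamental_group S (pathstart c)\<^esub> path_class S (conj_loop c q) =
    path_class S (conj_loop c q) \<otimes>\<^bsub>fundamental_group S (pathstart c)\<^esub> path_class S (conj_loop c p)"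
proof -
  note cl = conj_loop_in_loops_at [OF c]
  have "homotopic_paths S (conj_loop c p +++ conj_loop c q) (conj_loop c (p +++ q))"
    by (rule conj_loop_join [OF c p q])
  also have "homotopic_paths S \<dots> (conj_loop c (q +++ p))"
    using loops_atD [OF p] loops_atD [OF q] c unfolding conj_loop_def
    by (intro homotopic_paths_join pq) (auto simp: path_image_join)
  also have "homotopic_paths S \<dots> (conj_loop c q +++ conj_loop c p)"
    by (rule homotopic_paths_sym [OF conj_loop_join [OF c q p]])
  finally show ?thesis
    by (simp add: fundamental_group_mult cl p q path_class_eq)
qed

text \<open>The two loops are the sides of a square, and the two boundary paths from one corner to the
  opposite one are homotopic in the square.\<close>

lemma torus_loops_commute:
  fixes \<Theta> :: "real \<times> real \<Rightarrow> 'a::topological_space"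
  assumes cont: "continuous_on ({0..1} \<times> {0..1}) \<Theta>" and sub: "\<Theta> \<in> {0..1} \<times> {0..1} \<rightarrow> S"
    and per: "\<And>t. t \<in> {0..1} \<Longrightarrow> \<Theta> (1, t) = \<Theta> (0, t)" "\<And>t. t \<in> {0..1} \<Longrightarrow> \<Theta> (t, 1) = \<Theta> (t, 0)"
  shows "(\<lambda>t. \<Theta> (t, 0)) \<in> loops_at S (\<Theta> (0, 0))" "(\<lambda>t. \<Theta> (0, t)) \<in> loops_at S (\<Theta> (0, 0))"
    and "homotopic_paths S ((\<lambda>t. \<Theta> (t, 0)) +++ (\<lambda>t. \<Theta> (0, t))) ((\<lambda>t. \<Theta> (0, t)) +++ (\<lambda>t. \<Theta> (t, 0)))"
proof -
  let ?x = "\<lambda>t. \<Theta> (t, 0)" and ?y = "\<lambda>t. \<Theta> (0, t)"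
  have "continuous_on {0..1} (\<Theta> \<circ> (\<lambda>t. (t, 0)))" "continuous_on {0..1} (\<Theta> \<circ> (\<lambda>t. (0, t)))"
    by (intro continuous_on_compose continuous_intros continuous_on_subset [OF cont]; force)+
  then show "?x \<in> loops_at S (\<Theta> (0, 0))" "?y \<in> loops_at S (\<Theta> (0, 0))"
    using sub per by (auto simp: loops_at_def path_def path_image_def pathstart_def pathfinish_def o_def)
  let ?u = "linepath (0, 0) (1, 0) +++ linepath (1, 0) (1, 1::real) :: real \<Rightarrow> real \<times> real"
  let ?v = "linepath (0, 0) (0, 1) +++ linepath (0, 1) (1, 1::real) :: real \<Rightarrow> real \<times> real"
  have conv: "convex ({0..1} \<times> {0..1} :: (real \<times> real) set)"
    by (intro convex_Times) auto
  have "path_image ?u \<subseteq> {0..1} \<times> {0..1}" "path_image ?v \<subseteq> {0..1} \<times> {0..1}"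
    by (intro subset_path_image_join; simp only: path_image_linepath;
      intro closed_segment_subset conv; simp)+
  then have "homotopic_paths S (\<Theta> \<circ> ?u) (\<Theta> \<circ> ?v)"
    by (intro homotopic_paths_convex_image [OF conv cont sub]) auto
  moreover have "homotopic_paths S (\<Theta> \<circ> ?u) (?x +++ ?y)"
  proof (rule homotopic_paths_eq)
    show "path (\<Theta> \<circ> ?u)" "path_image (\<Theta> \<circ> ?u) \<subseteq> S"
      using calculation homotopic_paths_imp_path homotopic_paths_imp_subset by blast+
    show "(\<Theta> \<circ> ?u) t = (?x +++ ?y) t" if "t \<in> {0..1}" for t
      using that per by (auto simp: joinpaths_def linepath_def)
  qed
  moreover have "homotopic_paths S (\<Theta> \<circ> ?v) (?y +++ ?x)"
  proof (rule homotopic_paths_eq)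
    show "path (\<Theta> \<circ> ?v)" "path_image (\<Theta> \<circ> ?v) \<subseteq> S"
      using calculation homotopic_paths_imp_path homotopic_paths_imp_subset by blast+
    show "(\<Theta> \<circ> ?v) t = (?y +++ ?x) t" if "t \<in> {0..1}" for t
      using that per by (auto simp: joinpaths_def linepath_def)
  qed
  ultimately show "homotopic_paths S (?x +++ ?y) (?y +++ ?x)"
    by (meson homotopic_paths_sym homotopic_paths_trans)
qed

section \<open>Winding numbers\<close>

text \<open>The starting points differ by an element of the kernel of \<open>exp\<close>;
  translating \<open>v\<close> by it yields two lifts of one path with the same start, which agree
  by uniqueness of lifts.\<close>

lemma exp_lift_unique:
  fixes u v :: "real \<Rightarrow> complex"
  assumes "path u" "path v" "\<And>t. t \<in> {0..1} \<Longrightarrow> exp (u t) = exp (v t)" and t: "t \<in> {0..1}"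
  shows "u t - pathstart u = v t - pathstart v"
proof -
  define w where "w s = v s + (u 0 - v 0)" for s
  have "exp (w s) = exp (u s)" if "s \<in> {0..1}" for s
    using assms(3) [of 0] assms(3) [OF that] by (simp add: w_def exp_add exp_diff)
  then have ew: "(exp \<circ> u) s = exp (w s)" if "s \<in> {0..1}" for s
    using that by simp
  have cont: "continuous_on {0..1} u" "continuous_on {0..1} w"
    using assms(1,2) by (auto simp: path_def w_def [abs_def] intro!: continuous_intros)
  have "u t = w t"
    by (rule covering_space_lift_unique [where a = 0,
          OF covering_space_exp_punctured_plane _ _ _ cont(1) _ _ cont(2) _ ew])
      (use t cont(1) in \<open>auto simp: w_def o_def intro!: continuous_intros\<close>)
  then show ?thesis
    by (simp add: w_def pathstart_def)
qed

text \<open>The square is contractible, so the homotopy has a logarithm \<open>k\<close> on it,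
  which differs from the prescribed lifts by a constant \<open>c\<close> with
  \<open>exp c = 1\<close>. The lifted homotopy stays in the preimage of \<open>S\<close>; when
  \<open>S\<close> omits 1 it therefore avoids all points with exponential 1.\<close>

lemma exp_lift_homotopic_paths:
  fixes u v :: "real \<Rightarrow> complex"
  assumes hom: "homotopic_paths S p q" and "0 \<notin> S"
    and u: "path u" "\<And>t. t \<in> {0..1} \<Longrightarrow> exp (u t) = p t"
    and v: "path v" "\<And>t. t \<in> {0..1} \<Longrightarrow> exp (v t) = q t"
    and uv: "pathstart u = pathstart v"
  shows "homotopic_paths (exp -` S) u v"
proof -
  let ?Q = "{0..1::real} \<times> {0..1::real}"
  obtain h where h: "continuous_on ?Q h" "h \<in> ?Q \<rightarrow> S"
      "\<forall>x \<in> {0..1}. h (0, x) = p x" "\<forall>x \<in> {0..1}. h (1, x) = q x"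
      "\<forall>t \<in> {0..1}. pathstart (h \<circ> Pair t) = pathstart p \<and> pathfinish (h \<circ> Pair t) = pathfinish p"
    using hom unfolding homotopic_paths by blast
  have "contractible ?Q"
    by (intro convex_imp_contractible convex_Times) auto
  moreover have "h z \<noteq> 0" if "z \<in> ?Q" for z
    using funcset_mem [OF h(2) that] \<open>0 \<notin> S\<close> by auto
  ultimately obtain k where k: "continuous_on ?Q k" "\<And>z. z \<in> ?Q \<Longrightarrow> h z = exp (k z)"
    using continuous_logarithm_on_contractible [OF h(1)] by metis
  have pk: "path (\<lambda>x. k (t, x))" "path (\<lambda>x. k (x, t))" if "t \<in> {0..1}" for t
    unfolding path_def using that
    by (auto intro!: continuous_on_compose2 [OF k(1)] continuous_intros)
  define c where "c = k (0, 0) - u 0"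
  \<comment> \<open>On these two sides of the square the homotopy is constant, so \<open>k\<close>
    lifts a constant path there.\<close>
  have start: "k (t, 0) = k (0, 0)" "k (t, 1) = k (0, 1)" if "t \<in> {0..1}" for t
  proof -
    have expk: "exp (k (s, b)) = exp (k (0, b))" if "s \<in> {0..1}" "b \<in> {0, 1}" for s b
    proof -
      have "(s, b) \<in> ?Q" "(0, b) \<in> ?Q"
        using that by auto
      moreover have "h (s, b) = h (0, b)"
        using h(5) [rule_format, of s] h(5) [rule_format, of 0] that
        by (auto simp: pathstart_def pathfinish_def)
      ultimately show ?thesis
        using k(2) by metis
    qed
    have "k (t, b) - pathstart (\<lambda>s. k (s, b)) = k (0, b) - pathstart (\<lambda>_. k (0, b))"
      if b: "b \<in> {0, 1}" for b
    proof -
      have "b \<in> {0..1}"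
        using b by auto
      then show ?thesis
        using expk [OF _ b] \<open>t \<in> {0..1}\<close>
        by (rule exp_lift_unique [where u = "\<lambda>s. k (s, b)" and v = "\<lambda>_. k (0, b)", OF pk(2) path_const(1)])
    qed
    then have "k (t, b) = k (0, b)" if "b \<in> {0, 1}" for b
      using that by (simp add: pathstart_def)
    then show "k (t, 0) = k (0, 0)" "k (t, 1) = k (0, 1)"
      by auto
  qed
  have k0: "k (0, t) = u t + c" if "t \<in> {0..1}" for t
  proof -
    have "exp (k (0, s)) = exp (u s)" if "s \<in> {0..1}" for s
      using that h(3) k(2) [of "(0, s)"] u(2) [of s] by simp
    then show ?thesis
      using exp_lift_unique [OF pk(1) [of 0] u(1) _ that] by (simp add: pathstart_def c_def algebra_simps)
  qed
  have k1: "k (1, t) = v t + c" if "t \<in> {0..1}" for t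
  proof -
    have "exp (k (1, s)) = exp (v s)" if "s \<in> {0..1}" for s
      using that h(4) k(2) [of "(1, s)"] v(2) [of s] by simp
    then show ?thesis
      using exp_lift_unique [OF pk(1) [of 1] v(1) _ that] start [of 1] uv
      by (simp add: pathstart_def c_def algebra_simps)
  qed
  have "exp (u 0) = exp (u 0 + c)"
    using k0 [of 0] k(2) [of "(0, 0)"] h(3) u(2) [of 0] by auto
  then have c: "exp c = 1"
    by (simp add: exp_add)
  show ?thesis
    unfolding homotopic_paths
  proof (intro exI [of _ "\<lambda>z. k z - c"] conjI ballI)
    show "continuous_on ?Q (\<lambda>z. k z - c)"
      by (intro continuous_intros k)
    show "(\<lambda>z. k z - c) \<in> ?Q \<rightarrow> exp -` S"
      using k(2) h(2) c by (auto simp: exp_diff Pi_iff) 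
    show "k (0, x) - c = u x" "k (1, x) - c = v x" if "x \<in> {0..1}" for x
      using k0 k1 that by auto
    fix t :: real assume "t \<in> {0..1}"
    then show "pathstart ((\<lambda>z. k z - c) \<circ> Pair t) = pathstart u"
        "pathfinish ((\<lambda>z. k z - c) \<circ> Pair t) = pathfinish u"
      using start [of t] k0 by (auto simp: pathstart_def pathfinish_def)
  qed
qed

text \<open>The winding number about 1 is the integral along \<open>g\<close> of the logarithmic
  derivative of \<open>exp z - 1\<close>, whose poles are the points with \<open>exp z = 1\<close>.
  Since \<open>g\<close> winds around none of them, Cauchy's theorem gives 0.\<close>

lemma winding_number_exp_eq_0:
  assumes g: "path g" "pathfinish g = pathstart g" "\<And>z. z \<in> path_image g \<Longrightarrow> exp z \<noteq> 1"
    and wn: "\<And>z. exp z = 1 \<Longrightarrow> winding_number g z = 0"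
  shows "winding_number (exp \<circ> g) 1 = 0"
proof -
  define S where "S = {z::complex. exp z \<noteq> 1}"
  have S: "open S"
    unfolding S_def by (intro open_Collect_neq continuous_intros)
  have gS: "path_image g \<subseteq> S"
    using g(3) by (auto simp: S_def)
  obtain e where "e > 0" and e: "\<And>h. path h \<Longrightarrow> pathstart h = pathstart g \<Longrightarrow>
      pathfinish h = pathfinish g \<Longrightarrow> \<forall>t \<in> {0..1}. norm (h t - g t) < e \<Longrightarrow> homotopic_paths S g h"
    using homotopic_nearby_paths [OF g(1) S gS] by metis
  \<comment> \<open>Contour integrals need a smoother path than \<open>g\<close>; a close polynomial
    path is homotopic to \<open>g\<close> away from the poles.\<close>
  obtain p where p: "polynomial_function p" "pathstart p = pathstart g" "pathfinish p = pathfinish g"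
      "\<And>t. t \<in> {0..1} \<Longrightarrow> norm (p t - g t) < e"
    using path_approx_polynomial_function [OF g(1) \<open>e > 0\<close>] by metis
  have vp: "valid_path p"
    by (rule valid_path_polynomial_function [OF p(1)])
  have hom: "homotopic_paths S g p"
    using p valid_path_imp_path [OF vp] by (intro e) auto
  have pS: "path_image p \<subseteq> S"
    using homotopic_paths_imp_subset [OF hom] by auto
  have "homotopic_paths (- {1}) (exp \<circ> g) (exp \<circ> p)"
    by (rule homotopic_paths_continuous_image [OF hom]) (auto simp: S_def intro!: continuous_intros)
  then have "winding_number (exp \<circ> g) 1 = winding_number (exp \<circ> p) 1"
    by (rule winding_number_homotopic_paths)
  also have "\<dots> = 1 / (2 * pi * \<i>) * contour_integral (exp \<circ> p) (\<lambda>w. 1 / (w - 1))"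
  proof (rule winding_number_valid_path)
    show "valid_path (exp \<circ> p)"
      by (rule valid_path_compose_holomorphic [OF vp holomorphic_on_exp open_UNIV]) auto
    show "1 \<notin> path_image (exp \<circ> p)"
      using pS by (auto simp: path_image_compose S_def)
  qed
  also have "contour_integral (exp \<circ> p) (\<lambda>w. 1 / (w - 1)) =
      contour_integral p (\<lambda>w. deriv exp w * (1 / (exp w - 1)))"
    by (rule contour_integral_comp_analyticW [OF _ vp subset_UNIV]) (simp add: analytic_on_open holomorphic_on_exp)
  also have "\<dots> = 0"
  proof (rule contour_integral_unique [OF Cauchy_theorem_global [OF S _ vp _ pS]])
    show "(\<lambda>w. deriv exp w * (1 / (exp w - 1))) holomorphic_on S"
      using S by (auto simp: S_def intro!: holomorphic_intros)
    show "pathfinish p = pathstart p"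
      using p g by simp
    show "winding_number p w = 0" if "w \<notin> S" for w
    proof -
      have "homotopic_paths (- {w}) g p"
        using that by (intro homotopic_paths_subset [OF hom]) auto
      then show ?thesis
        using winding_number_homotopic_paths wn that by (fastforce simp: S_def)
    qed
  qed
  finally show ?thesis by (simp add: o_def)
qed

lemma exp_2pi_int: "exp (2 * of_real pi * \<i> * of_int n) = 1"
  by (metis exp_two_pi_i' exp_power_int mult.commute power_int_1_left)

text \<open>The loop \<open>p\<close> lifts along \<open>exp\<close> to a loop whose winding numbers about the points
  \<open>2 \<pi> i n\<close> are, by the lifted homotopy, periodic in \<open>n\<close>; so they all vanish.\<close>

lemma commuting_loops_winding_number_eq_0:
  assumes pq: "homotopic_paths (- {0, 1}) (p +++ q) (q +++ p)"
    and p: "p \<in> loops_at (- {0, 1}) s" and q: "q \<in> loops_at (- {0, 1}) s"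
    and wp: "winding_number p 0 = 0" and wq: "winding_number q 0 \<noteq> 0"
  shows "winding_number p 1 = 0"
proof -
  note pD = loops_atD [OF p] and qD = loops_atD [OF q]
  have "0 \<notin> path_image p" "0 \<notin> path_image q"
    using pD qD by auto
  obtain g where g: "path g" "pathfinish g = pathstart g" "\<And>t. t \<in> {0..1} \<Longrightarrow> p t = exp (g t)"
    by (rule winding_number_as_continuous_log [OF pD(1) \<open>0 \<notin> path_image p\<close>]) (simp add: wp)
  obtain h where h: "path h" "pathfinish h - pathstart h = 2 * of_real pi * \<i> * winding_number q 0"
      "\<And>t. t \<in> {0..1} \<Longrightarrow> q t = exp (h t)"
    by (rule winding_number_as_continuous_log [OF qD(1) \<open>0 \<notin> path_image q\<close>]) simp
  obtain m where m: "winding_number q 0 = of_int m"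
    using integer_winding_number [of q 0] qD by (auto elim: Ints_cases)
  have "exp (g 0) = exp (h 0)"
    using g(3) [of 0] h(3) [of 0] pD(3) qD(3) by (simp add: pathstart_def)
  \<comment> \<open>The lift of \<open>q\<close> translated to start where the closed lift
    \<open>g\<close> of \<open>p\<close> starts and ends.\<close>
  define H where "H t = h t + (g 0 - h 0)" for t
  have expH: "exp (H t) = exp (h t)" for t
    using \<open>exp (g 0) = exp (h 0)\<close> by (simp add: H_def exp_add exp_diff)
  have pathH: "path H"
    unfolding H_def path_def using h(1) by (auto simp: path_def intro!: continuous_intros)
  \<comment> \<open>The total increment of \<open>H\<close>. After following \<open>H\<close>, the
    path \<open>p\<close> lifts to the translate \<open>G\<close> of \<open>g\<close> by
    \<open>T\<close>, so \<open>p +++ q\<close> lifts to \<open>g +++ H\<close> and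
    \<open>q +++ p\<close> to \<open>H +++ G\<close>.\<close>
  define T where "T = 2 * of_real pi * \<i> * of_int m"
  have expT: "exp T = 1"
    by (simp add: T_def exp_2pi_int)
  define G where "G t = g t + T" for t
  have pathG: "path G"
    unfolding G_def path_def using g(1) by (auto simp: path_def intro!: continuous_intros)
  have ends: "pathstart H = pathstart g" "pathfinish H = pathstart g + T" "pathstart G = pathstart g + T"
    using h(2) m by (auto simp: H_def G_def T_def pathstart_def pathfinish_def algebra_simps)
  have hom: "homotopic_paths (exp -` (- {0, 1})) (g +++ H) (H +++ G)"
  proof (rule exp_lift_homotopic_paths [OF pq])
    show "exp ((g +++ H) t) = (p +++ q) t" if "t \<in> {0..1}" for t
      using that g(3) h(3) expH by (auto simp: joinpaths_def)
    show "exp ((H +++ G) t) = (q +++ p) t" if "t \<in> {0..1}" for t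
      using that g(3) h(3) expH expT by (auto simp: joinpaths_def G_def exp_add)
  qed (use g pathH pathG ends in auto)
  have notin: "z \<notin> path_image g" "z \<notin> path_image H" "z \<notin> path_image G" if "exp z = 1" for z
    using homotopic_paths_imp_subset [OF hom] that g(2) ends by (auto simp: path_image_join)
  \<comment> \<open>\<open>H\<close> contributes equally to both lifts and cancels, and winding of
    \<open>G\<close> about \<open>z\<close> is winding of \<open>g\<close> about
    \<open>z - T\<close>.\<close>
  have shift: "winding_number g z = winding_number g (z - T)" if z: "exp z = 1" for z
  proof -
    have "homotopic_paths (- {z}) (g +++ H) (H +++ G)"
      using z by (intro homotopic_paths_subset [OF hom]) auto
    then have "winding_number (g +++ H) z = winding_number (H +++ G) z"
      by (rule winding_number_homotopic_paths)
    then have "winding_number g z = winding_number G z"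
      using notin [OF z] g(1,2) pathH pathG ends by (simp add: winding_number_join)
    also have "\<dots> = winding_number g (z - T)"
      unfolding G_def using winding_number_offset [of "\<lambda>t. g t + T" z] winding_number_offset [of g "z - T"]
      by (simp add: algebra_simps)
    finally show ?thesis .
  qed
  have shifts: "winding_number g z = winding_number g (z - of_nat n * T)" if z: "exp z = 1" for z n
  proof (induction n)
    case (Suc n)
    have "exp (z - of_nat n * T) = 1"
      using z expT by (simp add: exp_diff exp_of_nat_mult)
    then show ?case
      using Suc shift by (simp add: algebra_simps)
  qed simp
  \<comment> \<open>Far from the origin the winding numbers of \<open>g\<close> vanish, and
    \<open>z - n T\<close> gets there because \<open>T \<noteq> 0\<close>; periodicity carries the
    zero back to \<open>z\<close>.\<close>
  obtain B where B: "\<And>z. B \<le> norm z \<Longrightarrow> winding_number g z = 0"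
    using winding_number_zero_at_infinity [OF g(1,2)] by blast
  have "T \<noteq> 0"
    using wq m by (simp add: T_def)
  have zero: "winding_number g z = 0" if z: "exp z = 1" for z
  proof -
    obtain n :: nat where n: "(B + norm z) / norm T \<le> of_nat n"
      using real_arch_simple by blast
    then have "B + norm z \<le> norm (of_nat n * T)"
      using \<open>T \<noteq> 0\<close> by (simp add: norm_mult field_simps)
    also have "\<dots> \<le> norm (z - of_nat n * T) + norm z"
      by (metis norm_minus_commute norm_triangle_sub add.commute)
    finally show ?thesis
      using shifts [OF z, of n] B by simp
  qed
  have "winding_number (exp \<circ> g) 1 = 0"
    by (rule winding_number_exp_eq_0) (use g notin zero in auto)
  moreover have "winding_number (exp \<circ> g) 1 = winding_number p 1"
    by (rule winding_number_cong) (simp add: g(3))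
  ultimately show ?thesis
    by simp
qed

lemma winding_number_mult:
  assumes p: "path p" "0 \<notin> path_image p" and q: "path q" "0 \<notin> path_image q"
  shows "winding_number (\<lambda>t. p t * q t) 0 = winding_number p 0 + winding_number q 0"
proof -
  obtain g where g: "path g" "pathfinish g - pathstart g = 2 * of_real pi * \<i> * winding_number p 0"
      "\<And>t. t \<in> {0..1} \<Longrightarrow> p t = 0 + exp (g t)"
    using winding_number_as_continuous_log [OF p] by metis
  obtain h where h: "path h" "pathfinish h - pathstart h = 2 * of_real pi * \<i> * winding_number q 0"
      "\<And>t. t \<in> {0..1} \<Longrightarrow> q t = 0 + exp (h t)"
    using winding_number_as_continuous_log [OF q] by metis
  have "path (\<lambda>t. g t + h t)"
    using g(1) h(1) by (auto simp: path_def intro!: continuous_intros)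
  then have "winding_number (exp \<circ> (\<lambda>t. g t + h t)) 0 =
      ((pathfinish g - pathstart g) + (pathfinish h - pathstart h)) / (2 * of_real pi * \<i>)"
    by (subst winding_number_compose_exp) (auto simp: pathstart_def pathfinish_def)
  also have "\<dots> = winding_number p 0 + winding_number q 0"
    unfolding g(2) h(2) by (simp add: field_simps)
  also have "winding_number (exp \<circ> (\<lambda>t. g t + h t)) 0 = winding_number (\<lambda>t. p t * q t) 0"
    by (rule winding_number_cong) (simp add: g(3) h(3) exp_add)
  finally show ?thesis .
qed

lemma winding_number_scale:
  assumes p: "path p" "0 \<notin> path_image p" and "c \<noteq> 0"
  shows "winding_number (\<lambda>t. c * p t) 0 = winding_number p 0"
proof -
  have "winding_number (\<lambda>t. (\<lambda>_. c) t * p t) 0 = winding_number (\<lambda>_. c) 0 + winding_number p 0"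
    using assms by (intro winding_number_mult) (auto simp: path_const)
  also have "winding_number (\<lambda>_::real. c) 0 = 0"
    using \<open>c \<noteq> 0\<close> by (intro winding_number_constI [of c]) auto
  finally show ?thesis
    by simp
qed

section \<open>Winding numbers as homomorphisms on the fundamental group\<close>

definition wind :: "('a::topological_space \<Rightarrow> complex) \<Rightarrow> (real \<Rightarrow> 'a) set \<Rightarrow> complex"
  where "wind f X = winding_number (f \<circ> (SOME p. p \<in> X)) 0"

lemma loops_at_compose:
  assumes "p \<in> loops_at S x" "continuous_on S f" "f \<in> S \<rightarrow> T"
  shows "f \<circ> p \<in> loops_at T (f x)"
  using assms
  by (auto simp: loops_at_def path_image_compose pathstart_compose pathfinish_compose
      intro!: path_continuous_image elim: continuous_on_subset)

text \<open>Makes the representative chosen in \<open>wind\<close> irrelevant: \<open>f\<close> has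
  no zeros on \<open>S\<close>, so it maps homotopies into the punctured plane.\<close>

lemma wind_path_class:
  assumes f: "continuous_on S f" "f \<in> S \<rightarrow> - {0}" and p: "p \<in> loops_at S x"
  shows "wind f (path_class S p) = winding_number (f \<circ> p) 0"
proof -
  have "p \<in> path_class S p"
    using p by (simp add: path_class_def loops_at_def)
  then have "(SOME q. q \<in> path_class S p) \<in> path_class S p"
    using someI [of "\<lambda>q. q \<in> path_class S p"] by blast
  then have "homotopic_paths S p (SOME q. q \<in> path_class S p)"
    by (simp add: path_class_def)
  then have "homotopic_paths (- {0}) (f \<circ> p) (f \<circ> (SOME q. q \<in> path_class S p))"
    using f by (rule homotopic_paths_continuous_image)
  then show ?thesis
    unfolding wind_def by (metis winding_number_homotopic_paths)
qed

lemma additive_on_wind: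
  assumes f: "continuous_on S f" "f \<in> S \<rightarrow> - {0}"
  shows "additive_on (fundamental_group S x) (wind f)"
  unfolding additive_on_def fundamental_group_carrier
proof (clarify)
  fix p q assume p: "p \<in> loops_at S x" and q: "q \<in> loops_at S x"
  have *: "winding_number (f \<circ> (p +++ q)) 0 = winding_number (f \<circ> p) 0 + winding_number (f \<circ> q) 0"
    unfolding path_compose_join
    using loops_atD [OF loops_at_compose [OF p f]] loops_atD [OF loops_at_compose [OF q f]]
    by (intro winding_number_join) auto
  show "wind f (path_class S p \<otimes>\<^bsub>fundamental_group S x\<^esub> path_class S q) =
      wind f (path_class S p) + wind f (path_class S q)"
    using p q *
    by (simp add: fundamental_group_mult wind_path_class [OF f] wind_path_class [OF f loops_at_join])
qed

lemma wind_Ints: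
  assumes f: "continuous_on S f" "f \<in> S \<rightarrow> - {0}" and X: "X \<in> carrier (fundamental_group S x)"
  shows "wind f X \<in> \<int>"
proof -
  obtain p where p: "X = path_class S p" "p \<in> loops_at S x"
    using X by (auto simp: fundamental_group_carrier)
  show ?thesis
    unfolding p(1) wind_path_class [OF f p(2)]
    using loops_atD [OF loops_at_compose [OF p(2) f]] by (intro integer_winding_number) auto
qed

lemma additive_on_int_pow:
  fixes n :: int
  assumes G: "group G" and a: "additive_on G a" and x: "x \<in> carrier G"
  shows "a (x [^]\<^bsub>G\<^esub> n) = of_int n * a x"
proof -
  interpret group G by fact
  have one: "a \<one>\<^bsub>G\<^esub> = 0"
    using additive_onD [OF a one_closed one_closed] by simp
  have nat: "a (x [^]\<^bsub>G\<^esub> m) = of_nat m * a x" for m :: nat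
    by (induction m) (auto simp: one additive_onD [OF a] x algebra_simps)
  have inv: "a (inv\<^bsub>G\<^esub> y) = - a y" if "y \<in> carrier G" for y
    using additive_onD [OF a inv_closed [OF that] that] that one
    by (simp add: eq_neg_iff_add_eq_0)
  show ?thesis
    using nat inv x by (cases n rule: int_cases4) (auto simp: int_pow_int int_pow_neg)
qed

lemma (in group) int_pow_commute:
  fixes n :: int
  assumes "x \<otimes> y = y \<otimes> x" and x: "x \<in> carrier G" and y: "y \<in> carrier G"
  shows "x [^] n \<otimes> y = y \<otimes> x [^] n"
proof -
  have pow: "x [^] m \<otimes> y = y \<otimes> x [^] m" for m :: nat
    using assms by (rule group_commutes_pow)
  then have "inv (x [^] m) \<otimes> y = y \<otimes> inv (x [^] m)" for m :: nat
    using x y by (metis inv_closed inv_solve_left' inv_solve_right m_assoc m_closed nat_pow_closed)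
  with pow show ?thesis
    using x by (cases n rule: int_cases4) (auto simp: int_pow_int int_pow_neg_int)
qed

text \<open>The classes of \<open>dF/F\<close> and \<open>dF/(F - 1)\<close> have cup product zero, since \<open>F\<close> takes values in a curve.
  Replacing \<open>X\<close> by \<open>X\<^sup>n Y\<^bsup>-m\<^esup>\<close>, with \<open>m\<close> and \<open>n\<close> the winding numbers of \<open>F\<close> along \<open>X\<close> and \<open>Y\<close>, reduces
  the claim to the case of winding number zero along \<open>X\<close>.\<close>

lemma commuting_wind_det:
  assumes F: "continuous_on S F" "F \<in> S \<rightarrow> - {0, 1}" and x: "x \<in> S"
    and X: "X \<in> carrier (fundamental_group S x)" and Y: "Y \<in> carrier (fundamental_group S x)"
    and comm: "X \<otimes>\<^bsub>fundamental_group S x\<^esub> Y = Y \<otimes>\<^bsub>fundamental_group S x\<^esub> X"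
  shows "wind F X * wind (\<lambda>z. F z - 1) Y = wind F Y * wind (\<lambda>z. F z - 1) X"
proof -
  let ?G = "fundamental_group S x" and ?a = "wind F" and ?b = "wind (\<lambda>z. F z - 1)"
  interpret G: group ?G
    by (rule group_fundamental_group [OF x])
  have F0: "F \<in> S \<rightarrow> - {0}" and F1: "continuous_on S (\<lambda>z. F z - 1)" "(\<lambda>z. F z - 1) \<in> S \<rightarrow> - {0}"
    using F by (auto intro!: continuous_intros)
  note a = additive_on_wind [OF F(1) F0, of x] and b = additive_on_wind [OF F1, of x]
  have weak: "?b U = 0"
    if U: "U \<in> carrier ?G" and V: "V \<in> carrier ?G" and UV: "U \<otimes>\<^bsub>?G\<^esub> V = V \<otimes>\<^bsub>?G\<^esub> U"
      and aU: "?a U = 0" and aV: "?a V \<noteq> 0" for U V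
  proof -
    obtain p q where p: "U = path_class S p" "p \<in> loops_at S x"
      and q: "V = path_class S q" "q \<in> loops_at S x"
      using U V by (auto simp: fundamental_group_carrier)
    have "q +++ p \<in> path_class S (q +++ p)"
      using loops_atD [OF loops_at_join [OF q(2) p(2)]] by (simp add: path_class_def)
    also have "path_class S (q +++ p) = path_class S (p +++ q)"
      using UV by (simp add: p q fundamental_group_mult)
    finally have "homotopic_paths S (p +++ q) (q +++ p)"
      by (simp add: path_class_def)
    then have "homotopic_paths (- {0, 1}) (F \<circ> (p +++ q)) (F \<circ> (q +++ p))"
      using F by (rule homotopic_paths_continuous_image)
    then have "homotopic_paths (- {0, 1}) ((F \<circ> p) +++ (F \<circ> q)) ((F \<circ> q) +++ (F \<circ> p))"
      by (simp add: path_compose_join)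
    moreover have "winding_number (F \<circ> p) 0 = 0" "winding_number (F \<circ> q) 0 \<noteq> 0"
      using aU aV unfolding p(1) q(1) wind_path_class [OF F(1) F0 p(2)] wind_path_class [OF F(1) F0 q(2)]
      by simp_all
    ultimately have "winding_number (F \<circ> p) 1 = 0"
      using loops_at_compose [OF p(2) F] loops_at_compose [OF q(2) F]
      by (intro commuting_loops_winding_number_eq_0)
    then show ?thesis
      using winding_number_offset [of "F \<circ> p" 1] 
      unfolding p(1) wind_path_class [OF F1 p(2)] by (simp add: o_def)
  qed
  obtain m n where m: "?a X = of_int m" and n: "?a Y = of_int n"
    using wind_Ints [OF F(1) F0] X Y by (metis Ints_cases)
  define Z where "Z = X [^]\<^bsub>?G\<^esub> n \<otimes>\<^bsub>?G\<^esub> Y [^]\<^bsub>?G\<^esub> (- m)"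
  have Z: "Z \<in> carrier ?G"
    using X Y by (simp add: Z_def)
  have "?a Z = 0" and bZ: "?b Z = ?a Y * ?b X - ?a X * ?b Y"
    using X Y by (simp_all add: Z_def additive_onD [OF a] additive_onD [OF b]
        additive_on_int_pow [OF G.group_axioms a] additive_on_int_pow [OF G.group_axioms b] m n)
  moreover have "Z \<otimes>\<^bsub>?G\<^esub> X = X \<otimes>\<^bsub>?G\<^esub> Z" "Z \<otimes>\<^bsub>?G\<^esub> Y = Y \<otimes>\<^bsub>?G\<^esub> Z"
    using G.int_pow_commute [OF comm X Y] G.int_pow_commute [OF comm [symmetric] Y X]
      G.int_pow_commute [OF refl X X] G.int_pow_commute [OF refl Y Y] X Y
    unfolding Z_def by (metis G.int_pow_closed G.m_assoc)+
  \<comment> \<open>\<open>Z\<close> commutes with \<open>X\<close> and \<open>Y\<close>, and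
    \<open>F\<close> has winding number zero along it, so \<open>weak\<close> applies with whichever
    of \<open>X\<close>, \<open>Y\<close> has nonzero winding number.\<close>
  ultimately have "?b Z = 0 \<or> ?a X = 0 \<and> ?a Y = 0"
    using weak X Y Z by blast
  then show ?thesis
    using bZ by auto
qed

section \<open>Lines and complements in the projective plane\<close>

definition form :: "complex ^ 3 \<Rightarrow> complex ^ 3 \<Rightarrow> complex"
  where "form a v = (\<Sum>i\<in>UNIV. a $ i * v $ i)"

lemma form_simps [simp]:
  "form a (v + w) = form a v + form a w" "form a (v - w) = form a v - form a w" "form a (c *s v) = c * form a v"
  "form (a + b) v = form a v + form b v" "form (c *s a) v = c * form a v" "form 0 v = 0" "form a 0 = 0"
  by (simp_all add: form_def sum_distrib_left algebra_simps sum.distrib sum_subtractf)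

lemma form_nondegenerate:
  assumes "a \<noteq> 0"
  shows "\<exists>u. form a u \<noteq> 0"
proof -
  obtain i where "a $ i \<noteq> 0"
    using assms by (auto simp: vec_eq_iff)
  moreover have "form a (axis i 1) = a $ i"
    by (simp add: form_def axis_def if_distrib cong: if_cong)
  ultimately show ?thesis
    by metis
qed

text \<open>A square matrix with rows \<open>a\<close>, \<open>b\<close>, \<open>c\<close> has a
  nontrivial kernel exactly when its rows are dependent. This translates concurrence of three lines
  into a relation between their equations.\<close>

lemma common_zero_iff_dependent:
  "(\<exists>v. v \<noteq> 0 \<and> form a v = 0 \<and> form b v = 0 \<and> form c v = 0) \<longleftrightarrow>
    (\<exists>\<alpha> \<beta> \<gamma>. (\<alpha> \<noteq> 0 \<or> \<beta> \<noteq> 0 \<or> \<gamma> \<noteq> 0) \<and> \<alpha> *s a + \<beta> *s b + \<gamma> *s c = 0)"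
  (is "?L \<longleftrightarrow> ?R")
proof -
  define M :: "complex ^ 3 ^ 3" where "M = vector [a, b, c]"
  have mult: "M *v v = vector [form a v, form b v, form c v]" for v
    by (simp add: vec_eq_iff forall_3 M_def matrix_vector_mult_def form_def)
  have row: "row 1 M = a" "row 2 M = b" "row 3 M = c"
    by (simp_all add: row_def M_def)
  have "?L \<longleftrightarrow> \<not> (\<exists>B. B ** M = mat 1)"
    unfolding matrix_left_invertible_ker mult by (auto simp: vec_eq_iff forall_3)
  also have "\<dots> \<longleftrightarrow> \<not> (\<exists>B. M ** B = mat 1)"
    by (simp add: matrix_left_right_inverse)
  also have "\<dots> \<longleftrightarrow> (\<exists>d :: 3 \<Rightarrow> complex. d 1 *s a + d 2 *s b + d 3 *s c = 0 \<and> (\<exists>i. d i \<noteq> 0))"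
    unfolding matrix_right_invertible_independent_rows by (auto simp: sum_3 row)
  also have "\<dots> \<longleftrightarrow> ?R"
  proof
    assume ?R
    then obtain \<alpha> \<beta> \<gamma> where *: "\<alpha> \<noteq> 0 \<or> \<beta> \<noteq> 0 \<or> \<gamma> \<noteq> 0" "\<alpha> *s a + \<beta> *s b + \<gamma> *s c = 0"
      by blast
    define d :: "3 \<Rightarrow> complex" where "d i = (vector [\<alpha>, \<beta>, \<gamma>] :: complex ^ 3) $ i" for i
    have "d 1 = \<alpha>" "d 2 = \<beta>" "d 3 = \<gamma>"
      by (simp_all add: d_def)
    then show "\<exists>d :: 3 \<Rightarrow> complex. d 1 *s a + d 2 *s b + d 3 *s c = 0 \<and> (\<exists>i. d i \<noteq> 0)"
      using * by (intro exI [of _ d]) auto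
  next
    assume "\<exists>d :: 3 \<Rightarrow> complex. d 1 *s a + d 2 *s b + d 3 *s c = 0 \<and> (\<exists>i. d i \<noteq> 0)"
    then obtain d :: "3 \<Rightarrow> complex" where d: "d 1 *s a + d 2 *s b + d 3 *s c = 0" "\<not> (\<forall>i. d i = 0)"
      by blast
    then show ?R
      unfolding forall_3 by (intro exI [of _ "d 1"] exI [of _ "d 2"] exI [of _ "d 3"]) blast
  qed
  finally show ?thesis .
qed

lemma common_zero_of_two: "\<exists>v. v \<noteq> 0 \<and> form a v = 0 \<and> form b v = 0"
proof -
  \<comment> \<open>Repeating \<open>b\<close> makes the three covectors trivially
    dependent.\<close>
  have "\<exists>v. v \<noteq> 0 \<and> form a v = 0 \<and> form b v = 0 \<and> form b v = 0"
    unfolding common_zero_iff_dependent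
    by (intro exI [of _ 0] exI [of _ 1] exI [of _ "- 1"]) (simp add: vec_eq_iff)
  then show ?thesis
    by blast
qed

lemma rep_cp2_nonzero [simp]: "rep_cp2 p \<noteq> 0"
  using Quotient3_rep_reflp [OF Quotient3_cp2] by auto

lemma abs_rep_cp2 [simp]: "abs_cp2 (rep_cp2 p) = p"
  using Quotient3_abs_rep [OF Quotient3_cp2] .

lemma abs_cp2_eq_iff:
  assumes "v \<noteq> 0" "w \<noteq> 0"
  shows "abs_cp2 v = abs_cp2 w \<longleftrightarrow> (\<exists>c. c \<noteq> 0 \<and> w = c *s v)"
proof -
  have refl: "u \<noteq> 0 \<and> u \<noteq> 0 \<and> (\<exists>c. c \<noteq> 0 \<and> u = c *s u)" if "u \<noteq> 0" for u :: "complex ^ 3"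
    using that by (auto intro: exI [of _ 1])
  show ?thesis
    using Quotient3_rel [OF Quotient3_cp2, of v w] assms refl [OF assms(1)] refl [OF assms(2)] by auto
qed

lemma rep_abs_cp2:
  assumes "v \<noteq> 0"
  obtains c where "c \<noteq> 0" "rep_cp2 (abs_cp2 v) = c *s v"
  using abs_cp2_eq_iff [of v "rep_cp2 (abs_cp2 v)"] assms by auto

text \<open>A choice of equation, unique up to a nonzero scalar; such a scalar does not affect
  winding numbers of quotients.\<close>

definition covector :: "cp2 set \<Rightarrow> complex ^ 3"
  where "covector H = (SOME a. a \<noteq> 0 \<and> H = abs_cp2 ` {v. v \<noteq> 0 \<and> form a v = 0})"

abbreviation eqn :: "cp2 set \<Rightarrow> complex ^ 3 \<Rightarrow> complex"
  where "eqn H \<equiv> form (covector H)"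

lemma covector:
  assumes "is_line H"
  shows "covector H \<noteq> 0" "H = abs_cp2 ` {v. v \<noteq> 0 \<and> eqn H v = 0}"
proof -
  have "\<exists>a. a \<noteq> 0 \<and> H = abs_cp2 ` {v. v \<noteq> 0 \<and> form a v = 0}"
    using assms by (simp add: is_line_def form_def)
  then have "covector H \<noteq> 0 \<and> H = abs_cp2 ` {v. v \<noteq> 0 \<and> eqn H v = 0}"
    unfolding covector_def by (rule someI_ex)
  then show "covector H \<noteq> 0" "H = abs_cp2 ` {v. v \<noteq> 0 \<and> eqn H v = 0}"
    by blast+
qed

lemma abs_cp2_mem_line:
  assumes H: "is_line H" and v: "v \<noteq> 0"
  shows "abs_cp2 v \<in> H \<longleftrightarrow> eqn H v = 0"
proof
  assume "abs_cp2 v \<in> H"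
  then have "abs_cp2 v \<in> abs_cp2 ` {w. w \<noteq> 0 \<and> eqn H w = 0}"
    by (simp only: covector(2) [OF H, symmetric])
  then obtain w where "w \<noteq> 0" "eqn H w = 0" "abs_cp2 w = abs_cp2 v"
    by auto
  then show "eqn H v = 0"
    using v by (auto simp: abs_cp2_eq_iff)
next
  assume "eqn H v = 0"
  then show "abs_cp2 v \<in> H"
    using v by (subst covector(2) [OF H]) blast
qed

lemma mem_line_iff: "is_line H \<Longrightarrow> p \<in> H \<longleftrightarrow> eqn H (rep_cp2 p) = 0"
  using abs_cp2_mem_line [of H "rep_cp2 p"] by simp

lemma dependent_covectors_imp_eq:
  assumes H: "is_line H" and K: "is_line K"
    and dep: "\<alpha> *s covector H + \<beta> *s covector K = 0" "\<alpha> \<noteq> 0 \<or> \<beta> \<noteq> 0"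
  shows "H = K"
proof -
  have "\<alpha> \<noteq> 0" "\<beta> \<noteq> 0"
    using dep covector(1) [OF H] covector(1) [OF K] by auto
  moreover have "\<alpha> * eqn H v + \<beta> * eqn K v = 0" for v
    using arg_cong [OF dep(1), of "\<lambda>a. form a v"] by simp
  ultimately have "eqn H v = 0 \<longleftrightarrow> eqn K v = 0" for v
    by (metis add.right_neutral add.left_neutral mult_eq_0_iff)
  then show ?thesis
    using covector(2) [OF H] covector(2) [OF K] by simp
qed

lemma separating_covector:
  assumes v: "v \<noteq> 0" and w: "w \<noteq> 0" and ne: "abs_cp2 v \<noteq> abs_cp2 w"
  shows "\<exists>b. form b v = 0 \<and> form b w \<noteq> 0"
proof (rule ccontr)
  assume no: "\<not> ?thesis"
  obtain i where i: "v $ i \<noteq> 0"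
    using v by (auto simp: vec_eq_iff)
  have "v $ i * w $ j = v $ j * w $ i" for j
  proof -
    \<comment> \<open>Evaluating \<open>?b\<close> at a vector gives a 2 by 2 minor of it with
      \<open>v\<close>. If all these minors vanish at \<open>w\<close>, then \<open>w\<close> is a
      multiple of \<open>v\<close>.\<close>
    let ?b = "v $ i *s axis j 1 + (- v $ j) *s axis i 1"
    have ax: "form (axis l 1) u = u $ l" for l u
      by (simp add: form_def axis_def if_distrib if_distribR cong: if_cong)
    have "form ?b v = 0"
      by (simp only: form_simps ax) simp
    with no have "form ?b w = 0"
      by blast
    then show ?thesis
      by (simp only: form_simps ax) simp
  qed
  then have eq: "w = (w $ i / v $ i) *s v"
    using i by (simp add: vec_eq_iff field_simps)
  moreover have "w $ i / v $ i \<noteq> 0"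
    using w eq by (metis vec.scale_zero_left)
  ultimately show False
    using abs_cp2_eq_iff [OF v w] ne by blast
qed

text \<open>A covector \<open>b\<close> vanishing at \<open>v\<close> but not at \<open>w\<close>
  shares the zero \<open>v\<close> with both equations, so the three are dependent; evaluation at
  \<open>w\<close> removes \<open>b\<close> from the relation, leaving a dependence between the
  equations of \<open>H\<close> and \<open>K\<close>.\<close>

lemma lines_meet_at_most_once:
  assumes H: "is_line H" and K: "is_line K" and "H \<noteq> K"
    and v: "v \<noteq> 0" "eqn H v = 0" "eqn K v = 0" and w: "w \<noteq> 0" "eqn H w = 0" "eqn K w = 0"
  shows "abs_cp2 v = abs_cp2 w"
proof (rule ccontr)
  assume "abs_cp2 v \<noteq> abs_cp2 w"
  then obtain b where b: "form b v = 0" "form b w \<noteq> 0"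
    using separating_covector v w by blast
  then obtain \<alpha> \<beta> \<gamma> where *: "\<alpha> \<noteq> 0 \<or> \<beta> \<noteq> 0 \<or> \<gamma> \<noteq> 0"
      "\<alpha> *s covector H + \<beta> *s covector K + \<gamma> *s b = 0"
    using common_zero_iff_dependent [of "covector H" "covector K" b] v by blast
  have "\<gamma> = 0"
    using arg_cong [OF *(2), of "\<lambda>a. form a w"] w b by simp
  then show False
    using * dependent_covectors_imp_eq [OF H K] \<open>H \<noteq> K\<close> by auto
qed

lemma lines_through_two_points_eq:
  assumes "is_line H" "is_line K" "p \<noteq> q" "p \<in> H" "q \<in> H" "p \<in> K" "q \<in> K"
  shows "H = K"
  using lines_meet_at_most_once [of H K "rep_cp2 p" "rep_cp2 q"] assms by (auto simp: mem_line_iff)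

lemma lines_meet:
  assumes "is_line H" "is_line K"
  shows "\<exists>z. z \<in> H \<and> z \<in> K"
proof -
  obtain v where "v \<noteq> 0" "eqn H v = 0" "eqn K v = 0"
    using common_zero_of_two by blast
  then show ?thesis
    using assms by (intro exI [of _ "abs_cp2 v"]) (simp add: abs_cp2_mem_line)
qed

lemma other_point_on_line:
  assumes H: "is_line H" and v: "v \<noteq> 0"
  shows "\<exists>w. w \<noteq> 0 \<and> eqn H w = 0 \<and> abs_cp2 w \<noteq> abs_cp2 v"
proof -
  have "\<exists>b. form b v \<noteq> 0"
    using form_nondegenerate [OF v] by (auto simp: form_def mult.commute)
  then obtain b where b: "form b v \<noteq> 0"
    by blast
  obtain w where w: "w \<noteq> 0" "eqn H w = 0" "form b w = 0"
    using common_zero_of_two by blast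
  then have "abs_cp2 w \<noteq> abs_cp2 v"
    using b v by (auto simp: abs_cp2_eq_iff)
  with w show ?thesis
    by blast
qed

section \<open>Quotients of equations on the complement\<close>

definition ratio :: "cp2 set \<Rightarrow> cp2 set \<Rightarrow> cp2 \<Rightarrow> complex"
  where "ratio H K p = eqn H (rep_cp2 p) / eqn K (rep_cp2 p)"

text \<open>Numerator and denominator are homogeneous of the same degree, so the scalar between
  \<open>v\<close> and the chosen representative cancels.\<close>

lemma ratio_abs_cp2:
  assumes "v \<noteq> 0"
  shows "ratio H K (abs_cp2 v) = eqn H v / eqn K v"
  using assms by (rule rep_abs_cp2) (simp add: ratio_def)

lemma continuous_on_form [continuous_intros]:
  "continuous_on S f \<Longrightarrow> continuous_on S (\<lambda>x. form a (f x))"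
  unfolding form_def by (intro continuous_intros)

lemma continuous_on_abs_cp2: "continuous_on (- {0}) abs_cp2"
  unfolding continuous_on_open_vimage [OF open_Compl [OF closed_singleton]]
proof (intro allI impI)
  fix U :: "cp2 set" assume "open U"
  moreover have "abs_cp2 -` U \<inter> - {0} = {v. v \<noteq> 0 \<and> abs_cp2 v \<in> U}"
    by auto
  ultimately show "open (abs_cp2 -` U \<inter> - {0})"
    by (simp add: open_cp2_def)
qed

lemma eqn_nonzero:
  assumes "line_arrangement A" "H \<in> A" "p \<in> arr_complement A"
  shows "eqn H (rep_cp2 p) \<noteq> 0"
  using assms mem_line_iff [of H p] by (auto simp: line_arrangement_def arr_complement_def)

lemma abs_cp2_in_complement:
  assumes A: "line_arrangement A" and v: "\<And>H. H \<in> A \<Longrightarrow> eqn H v \<noteq> 0"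
  shows "v \<noteq> 0" "abs_cp2 v \<in> arr_complement A"
proof -
  obtain H where "H \<in> A"
    using A by (auto simp: line_arrangement_def)
  then show v0: "v \<noteq> 0"
    using v [of H] by auto
  show "abs_cp2 v \<in> arr_complement A"
    using A v abs_cp2_mem_line [OF _ v0] by (auto simp: arr_complement_def line_arrangement_def)
qed

lemma open_arr_complement:
  assumes A: "line_arrangement A"
  shows "open (arr_complement A)"
proof -
  have "v \<noteq> 0 \<and> abs_cp2 v \<in> arr_complement A \<longleftrightarrow> (\<forall>H\<in>A. eqn H v \<noteq> 0)" for v
    using A abs_cp2_in_complement [OF A, of v] abs_cp2_mem_line [of _ v]
    by (auto simp: arr_complement_def line_arrangement_def)
  then have "{v. v \<noteq> 0 \<and> abs_cp2 v \<in> arr_complement A} = (\<Inter>H\<in>A. {v. eqn H v \<noteq> 0})"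
    by auto
  then show ?thesis
    unfolding open_cp2_def using A
    by (auto simp: line_arrangement_def intro!: open_INT open_Collect_neq continuous_intros)
qed

text \<open>\<open>rep_cp2\<close> is an arbitrary choice of representatives, so continuity is
  tested through the quotient topology: on the nonzero vectors the function is a quotient of linear
  forms.\<close>

lemma ratio_continuous:
  assumes A: "line_arrangement A" and H: "H \<in> A" and K: "K \<in> A"
  shows "continuous_on (arr_complement A) (ratio H K)" "ratio H K \<in> arr_complement A \<rightarrow> - {0}"
proof -
  let ?M = "arr_complement A"
  show "ratio H K \<in> ?M \<rightarrow> - {0}"
    using eqn_nonzero [OF A] H K by (auto simp: ratio_def)
  show "continuous_on ?M (ratio H K)"
    unfolding continuous_on_open_vimage [OF open_arr_complement [OF A]]
  proof (intro allI impI)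
    fix U :: "complex set" assume U: "open U"
    let ?V = "{v. v \<noteq> 0 \<and> abs_cp2 v \<in> ?M}"
    have V: "open ?V"
      using open_arr_complement [OF A] by (simp add: open_cp2_def)
    have K0: "eqn K v \<noteq> 0" if "v \<in> ?V" for v
      using that K A abs_cp2_mem_line [of K v] by (auto simp: arr_complement_def line_arrangement_def)
    have "continuous_on ?V (\<lambda>v. eqn H v / eqn K v)"
      using K0 by (intro continuous_intros) auto
    then have "open ((\<lambda>v. eqn H v / eqn K v) -` U \<inter> ?V)"
      using U V by (simp add: continuous_on_open_vimage)
    moreover have "{v. v \<noteq> 0 \<and> abs_cp2 v \<in> ratio H K -` U \<inter> ?M} = (\<lambda>v. eqn H v / eqn K v) -` U \<inter> ?V"
      using ratio_abs_cp2 by auto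
    ultimately show "open (ratio H K -` U \<inter> ?M)"
      by (simp add: open_cp2_def)
  qed
qed

lemma continuous_on_affine_line [continuous_intros]:
  fixes f :: "'a::topological_space \<Rightarrow> complex" and v w :: "complex ^ 3"
  assumes "continuous_on S f"
  shows "continuous_on S (\<lambda>x. v + f x *s w)"
proof -
  have "continuous_on S (\<lambda>x. \<chi> i. v $ i + f x * w $ i)"
    using assms by (intro continuous_intros)
  then show ?thesis
    by (simp add: plus_vec_def vector_scalar_mult_def)
qed

text \<open>On the complex line joining representatives of the two points, each equation is nonzero
  at both ends and so vanishes for at most one parameter. The complex plane minus the finite set
  \<open>bad\<close> of these parameters is path connected.\<close>

lemma arr_complement_path_connected:
  assumes A: "line_arrangement A" and x: "x \<in> arr_complement A" and y: "y \<in> arr_complement A"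
  shows "\<exists>c. path c \<and> path_image c \<subseteq> arr_complement A \<and> pathstart c = x \<and> pathfinish c = y"
proof -
  let ?v = "rep_cp2 x" and ?w = "rep_cp2 y"
  have vw: "eqn H ?v \<noteq> 0" "eqn H ?w \<noteq> 0" if "H \<in> A" for H
    using eqn_nonzero [OF A that] x y by auto
  define bad where "bad = (\<lambda>H. eqn H ?v / (eqn H ?v - eqn H ?w)) ` {H \<in> A. eqn H ?v \<noteq> eqn H ?w}"
  define f where "f t = ?v + t *s (?w - ?v)" for t
  have f: "eqn H (f t) \<noteq> 0" if "t \<notin> bad" "H \<in> A" for t H
  proof
    assume 0: "eqn H (f t) = 0"
    then have "t * (eqn H ?v - eqn H ?w) = eqn H ?v"
      by (simp add: f_def algebra_simps)
    moreover from this have "eqn H ?v - eqn H ?w \<noteq> 0"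
      using vw [OF that(2)] by auto
    ultimately have "t = eqn H ?v / (eqn H ?v - eqn H ?w)" "eqn H ?v \<noteq> eqn H ?w"
      by (simp_all add: eq_divide_eq)
    then show False
      using that by (auto simp: bad_def)
  qed
  have "path_connected (- bad)"
    using A by (intro path_connected_complement_countable)
      (auto simp: bad_def line_arrangement_def intro: countable_finite)
  moreover have "0 \<in> - bad" "1 \<in> - bad"
    using vw by (auto simp: bad_def divide_eq_eq eq_divide_eq)
  ultimately obtain g where g: "path g" "path_image g \<subseteq> - bad" "pathstart g = 0" "pathfinish g = 1"
    unfolding path_connected_def by blast
  have fM: "f t \<noteq> 0" "abs_cp2 (f t) \<in> arr_complement A" if "t \<notin> bad" for t
    using abs_cp2_in_complement [OF A f [OF that]] by auto
  have "continuous_on (- bad) (\<lambda>t. abs_cp2 (f t))"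
    using fM unfolding f_def
    by (intro continuous_on_compose2 [OF continuous_on_abs_cp2] continuous_intros) auto
  then have "path ((\<lambda>t. abs_cp2 (f t)) \<circ> g)"
    using g by (intro path_continuous_image) (auto elim: continuous_on_subset)
  moreover have "path_image ((\<lambda>t. abs_cp2 (f t)) \<circ> g) \<subseteq> arr_complement A"
    using g(2) fM by (auto simp: path_image_compose)
  moreover have "f 0 = ?v" "f 1 = ?w"
    by (simp_all add: f_def vec_eq_iff)
  ultimately show ?thesis
    using g(3,4) by (intro exI [of _ "(\<lambda>t. abs_cp2 (f t)) \<circ> g"]) (simp add: pathstart_compose pathfinish_compose)
qed

lemma wind_scale:
  assumes f: "continuous_on S f" "f \<in> S \<rightarrow> - {0}" and g: "\<And>z. z \<in> S \<Longrightarrow> g z = c * f z" and "c \<noteq> 0"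
    and X: "X \<in> carrier (fundamental_group S x)"
  shows "wind g X = wind f X"
proof -
  obtain p where p: "X = path_class S p" "p \<in> loops_at S x"
    using X by (auto simp: fundamental_group_carrier)
  have "continuous_on S (\<lambda>z. c * f z)"
    using f by (intro continuous_intros)
  then have g': "continuous_on S g" "g \<in> S \<rightarrow> - {0}"
    using f g \<open>c \<noteq> 0\<close> by (auto cong: continuous_on_cong)
  have "winding_number (g \<circ> p) 0 = winding_number (\<lambda>t. c * (f \<circ> p) t) 0"
    using loops_atD(2) [OF p(2)] g by (intro winding_number_cong) (force simp: path_image_def)
  also have "\<dots> = winding_number (f \<circ> p) 0"
    using loops_atD [OF loops_at_compose [OF p(2) f]] \<open>c \<noteq> 0\<close>
    by (intro winding_number_scale) (auto simp del: o_apply)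
  finally show ?thesis
    by (simp only: p(1) wind_path_class [OF f p(2)] wind_path_class [OF g' p(2)])
qed

lemma wind_ratio_add:
  assumes A: "line_arrangement A" and H: "H \<in> A" and K: "K \<in> A" and L: "L \<in> A"
    and X: "X \<in> carrier (fundamental_group (arr_complement A) x)"
  shows "wind (ratio H L) X = wind (ratio H K) X + wind (ratio K L) X"
proof -
  let ?M = "arr_complement A"
  obtain p where p: "X = path_class ?M p" "p \<in> loops_at ?M x"
    using X by (auto simp: fundamental_group_carrier)
  note c = loops_atD [OF loops_at_compose [OF p(2) ratio_continuous [OF A]]]
  have "eqn K (rep_cp2 (p t)) \<noteq> 0" if "0 \<le> t" "t \<le> 1" for t
    using loops_atD(2) [OF p(2)] that by (intro eqn_nonzero [OF A K]) (auto simp: path_image_def)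
  then have "winding_number (ratio H L \<circ> p) 0 = winding_number (\<lambda>t. (ratio H K \<circ> p) t * (ratio K L \<circ> p) t) 0"
    by (intro winding_number_cong) (simp add: ratio_def)
  also have "\<dots> = winding_number (ratio H K \<circ> p) 0 + winding_number (ratio K L \<circ> p) 0"
    using c(1,2) H K L by (intro winding_number_mult) blast+
  finally show ?thesis
    by (simp only: p(1) wind_path_class [OF ratio_continuous [OF A H L] p(2)]
      wind_path_class [OF ratio_continuous [OF A H K] p(2)] wind_path_class [OF ratio_continuous [OF A K L] p(2)])
qed

text \<open>The relation between the equations of three concurrent lines, divided by \<alpha> times
  the equation of \<open>H\<close>, exhibits \<open>F\<close> and \<open>F - 1\<close> as nonzero
  multiples of \<open>ratio K H\<close> and \<open>ratio L H\<close>.\<close>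

lemma wind_ratio_pencil_det:
  assumes A: "line_arrangement A" and HKL: "H \<in> A" "K \<in> A" "L \<in> A" "H \<noteq> K" "K \<noteq> L" "L \<noteq> H"
    and p: "p \<in> H" "p \<in> K" "p \<in> L" and x: "x \<in> arr_complement A"
    and X: "X \<in> carrier (fundamental_group (arr_complement A) x)"
    and Y: "Y \<in> carrier (fundamental_group (arr_complement A) x)"
    and comm: "X \<otimes>\<^bsub>fundamental_group (arr_complement A) x\<^esub> Y =
      Y \<otimes>\<^bsub>fundamental_group (arr_complement A) x\<^esub> X"
  shows "wind (ratio K H) X * wind (ratio L H) Y = wind (ratio K H) Y * wind (ratio L H) X"
proof -
  let ?M = "arr_complement A"
  have lines: "is_line H" "is_line K" "is_line L"
    using A HKL by (auto simp: line_arrangement_def)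
  have "\<exists>v. v \<noteq> 0 \<and> eqn H v = 0 \<and> eqn K v = 0 \<and> eqn L v = 0"
    using p lines by (intro exI [of _ "rep_cp2 p"]) (simp add: mem_line_iff)
  then obtain \<alpha> \<beta> \<gamma> where ne: "\<alpha> \<noteq> 0 \<or> \<beta> \<noteq> 0 \<or> \<gamma> \<noteq> 0"
    and dep: "\<alpha> *s covector H + \<beta> *s covector K + \<gamma> *s covector L = 0"
    unfolding common_zero_iff_dependent by blast
  \<comment> \<open>A vanishing coefficient would leave a relation between two equations and
    identify two of the lines.\<close>
  have nz: "\<alpha> \<noteq> 0" "\<beta> \<noteq> 0" "\<gamma> \<noteq> 0"
    using dep ne dependent_covectors_imp_eq [OF lines(1,2), of \<alpha> \<beta>]
      dependent_covectors_imp_eq [OF lines(2,3), of \<beta> \<gamma>] dependent_covectors_imp_eq [OF lines(3,1), of \<gamma> \<alpha>] HKL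
    by (auto simp: add.commute)
  define F where "F z = - (\<beta> / \<alpha>) * ratio K H z" for z
  have F1: "F z - 1 = (\<gamma> / \<alpha>) * ratio L H z" if "z \<in> ?M" for z
  proof -
    have "\<alpha> * eqn H (rep_cp2 z) + \<beta> * eqn K (rep_cp2 z) + \<gamma> * eqn L (rep_cp2 z) = 0"
      using arg_cong [OF dep, of "\<lambda>a. form a (rep_cp2 z)"] by simp
    then show ?thesis
      using nz eqn_nonzero [OF A HKL(1) that]
      by (simp add: F_def ratio_def field_simps) (simp add: eq_neg_iff_add_eq_0 neg_eq_iff_add_eq_0 algebra_simps)
  qed
  note KH = ratio_continuous [OF A HKL(2,1)] and LH = ratio_continuous [OF A HKL(3,1)]
  have "continuous_on ?M F"
    unfolding F_def using KH by (intro continuous_intros)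
  moreover have "F \<in> ?M \<rightarrow> - {0, 1}"
  proof
    fix z assume z: "z \<in> ?M"
    have "F z \<noteq> 0"
      using KH(2) nz z by (auto simp: F_def)
    moreover have "F z - 1 \<noteq> 0"
      using LH(2) nz z by (auto simp: F1)
    ultimately show "F z \<in> - {0, 1}"
      by auto
  qed
  ultimately have "wind F X * wind (\<lambda>z. F z - 1) Y = wind F Y * wind (\<lambda>z. F z - 1) X"
    using x X Y comm by (rule commuting_wind_det)
  moreover have "wind F Z = wind (ratio K H) Z" "wind (\<lambda>z. F z - 1) Z = wind (ratio L H) Z"
    if "Z \<in> carrier (fundamental_group ?M x)" for Z
  proof -
    show "wind F Z = wind (ratio K H) Z"
      using nz by (intro wind_scale [OF KH _ _ that, where c = "- (\<beta> / \<alpha>)"]) (auto simp: F_def)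
    show "wind (\<lambda>z. F z - 1) Z = wind (ratio L H) Z"
      using nz by (intro wind_scale [OF LH F1 _ that]) auto
  qed
  ultimately show ?thesis
    using X Y by simp
qed

lemma wind_conj_loop:
  assumes f: "continuous_on S f" "f \<in> S \<rightarrow> - {0}" and c: "path c" "path_image c \<subseteq> S"
    and p: "p \<in> loops_at S (pathfinish c)"
  shows "wind f (path_class S (conj_loop c p)) = winding_number (f \<circ> p) 0"
proof -
  note p' = loops_atD [OF loops_at_compose [OF p f]]
  have c': "path (f \<circ> c)" "0 \<notin> path_image (f \<circ> c)"
    using c f by (auto simp: path_image_compose intro!: path_continuous_image elim: continuous_on_subset)
  have "winding_number (f \<circ> conj_loop c p) 0 =
      winding_number (((f \<circ> c) +++ (f \<circ> p)) +++ reversepath (f \<circ> c)) 0"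
    by (simp add: conj_loop_def path_compose_join path_compose_reversepath)
  also have "\<dots> = winding_number (f \<circ> p) 0"
    using p' c'
    by (auto simp: winding_number_join winding_number_reversepath path_image_join
        pathstart_compose pathfinish_compose)
  finally show ?thesis
    by (simp only: wind_path_class [OF f conj_loop_in_loops_at [OF c p]])
qed

section \<open>Tori at points of the arrangement\<close>

lemma winding_number_small_perturbation:
  assumes f: "path f" "pathfinish f = pathstart f" and small: "\<And>t. t \<in> {0..1} \<Longrightarrow> norm (f t) < norm c"
  shows "winding_number (\<lambda>t. c + f t) 0 = 0"
proof (rule winding_number_zero_outside [where s = "ball c (norm c)"])
  show "path (\<lambda>t. c + f t)"
    using f(1) by (auto simp: path_def intro!: continuous_intros)
  show "path_image (\<lambda>t. c + f t) \<subseteq> ball c (norm c)"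
    using small by (auto simp: path_image_def dist_norm)
qed (use f in \<open>auto simp: pathstart_def pathfinish_def dist_norm\<close>)

lemma winding_number_unit_circle: "winding_number (\<lambda>t. exp (2 * of_real pi * \<i> * of_real t)) 0 = 1"
proof -
  have "path (\<lambda>t. 2 * of_real pi * \<i> * complex_of_real t)"
    unfolding path_def by (intro continuous_intros)
  from winding_number_compose_exp [OF this] show ?thesis
    by (simp add: o_def pathstart_def pathfinish_def)
qed

lemma winding_number_divide:
  assumes "path p" "0 \<notin> path_image p" "path q" "0 \<notin> path_image q"
  shows "winding_number (\<lambda>t. p t / q t) 0 = winding_number p 0 - winding_number q 0"
proof -
  have nz: "p t \<noteq> 0" "q t \<noteq> 0" if "t \<in> {0..1}" for t
    using assms(2,4) that unfolding path_image_def by force+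
  have "path (\<lambda>t. p t / q t)" "0 \<notin> path_image (\<lambda>t. p t / q t)"
    using assms(1,3) nz by (auto simp: path_def path_image_def intro!: continuous_intros)
  then have "winding_number (\<lambda>t. (p t / q t) * q t) 0 = winding_number (\<lambda>t. p t / q t) 0 + winding_number q 0"
    using assms by (intro winding_number_mult)
  moreover have "winding_number (\<lambda>t. (p t / q t) * q t) 0 = winding_number p 0"
    using nz by (intro winding_number_cong) auto
  ultimately show ?thesis
    by (metis add_diff_cancel_right')
qed

text \<open>Supplies the two radii of the torus: finitely many strict inequalities that hold in the
  limit 0 hold for a small positive scale.\<close>

lemma small_scale_exists:
  fixes f g :: "'a \<Rightarrow> real"
  assumes "finite A" "\<And>x. x \<in> A \<Longrightarrow> 0 < f x"
  shows "\<exists>\<epsilon>>0. \<forall>x\<in>A. \<epsilon> * g x < f x"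
proof -
  have "eventually (\<lambda>\<epsilon>. \<epsilon> * g x < f x) (at_right 0)" if "x \<in> A" for x
  proof -
    have "((\<lambda>\<epsilon>. \<epsilon> * g x) \<longlongrightarrow> 0 * g x) (at_right 0)"
      by (intro tendsto_intros)
    then show ?thesis
      using assms(2) [OF that] by (intro order_tendstoD(2)) auto
  qed
  then have "eventually (\<lambda>\<epsilon>. \<forall>x\<in>A. \<epsilon> * g x < f x) (at_right 0)"
    using assms(1) by (simp add: eventually_ball_finite)
  then have "eventually (\<lambda>\<epsilon>. 0 < \<epsilon> \<and> (\<forall>x\<in>A. \<epsilon> * g x < f x)) (at_right (0::real))"
    using eventually_at_right_less by (rule eventually_elim2) auto
  then show ?thesis
    using eventually_happens trivial_limit_at_right_real by blast
qed

text \<open>Near \<open>z\<close>, the torus of the points \<open>v + \<epsilon> e(s) (w + \<eta> e(t) u)\<close>, where \<open>v\<close> represents \<open>z\<close>,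
  \<open>w\<close> another point of \<open>H\<close> and \<open>u\<close> a point off \<open>H\<close>: the circle in \<open>t\<close> is a meridian of \<open>H\<close>,
  and the one in \<open>s\<close> goes around all the lines through \<open>z\<close>.\<close>

lemma torus_at_point:
  assumes A: "line_arrangement A" and H: "H \<in> A" and z: "z \<in> H" and x: "x \<in> arr_complement A"
  obtains X Y where "X \<in> carrier (fundamental_group (arr_complement A) x)"
    "Y \<in> carrier (fundamental_group (arr_complement A) x)"
    "X \<otimes>\<^bsub>fundamental_group (arr_complement A) x\<^esub> Y = Y \<otimes>\<^bsub>fundamental_group (arr_complement A) x\<^esub> X"
    "\<And>K L. K \<in> A \<Longrightarrow> L \<in> A \<Longrightarrow> wind (ratio K L) X = of_bool (K = H) - of_bool (L = H)"
    "\<And>K L. K \<in> A \<Longrightarrow> L \<in> A \<Longrightarrow> wind (ratio K L) Y = of_bool (z \<in> K) - of_bool (z \<in> L)"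
proof -
  let ?M = "arr_complement A"
  have line: "is_line K" if "K \<in> A" for K
    using A that by (simp add: line_arrangement_def)
  have fin: "finite A"
    using A by (simp add: line_arrangement_def)
  define v where "v = rep_cp2 z"
  have v: "v \<noteq> 0" "abs_cp2 v = z"
    by (simp_all add: v_def)
  have zK: "z \<in> K \<longleftrightarrow> eqn K v = 0" if "K \<in> A" for K
    using mem_line_iff [OF line [OF that]] by (simp add: v_def)
  obtain w where w: "w \<noteq> 0" "eqn H w = 0" "abs_cp2 w \<noteq> z"
    using other_point_on_line [OF line [OF H] v(1)] v(2) by blast
  obtain u where u: "eqn H u \<noteq> 0"
    using form_nondegenerate covector(1) [OF line [OF H]] by blast
  \<comment> \<open>Such a line meets \<open>H\<close> only in \<open>z\<close>, and
    \<open>w\<close> represents another point of \<open>H\<close>.\<close>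
  have wK: "eqn K w \<noteq> 0" if "K \<in> A" "K \<noteq> H" "eqn K v = 0" for K
    using lines_meet_at_most_once [OF line [OF H] line [OF that(1)] _ v(1) _ that(3) w(1,2)] that w z v zK [OF H]
    by auto
  obtain \<eta> :: real where \<eta>: "\<eta> > 0" "\<And>K. K \<in> A \<Longrightarrow> eqn K w \<noteq> 0 \<Longrightarrow> \<eta> * norm (eqn K u) < norm (eqn K w)"
    using small_scale_exists [of "{K \<in> A. eqn K w \<noteq> 0}" "\<lambda>K. norm (eqn K w)" "\<lambda>K. norm (eqn K u)"] fin
    by auto
  \<comment> \<open>Chosen after \<eta>: on lines missing \<open>z\<close> the constant term
    dominates everything else, while \<eta> handles the lines through \<open>z\<close> other than
    \<open>H\<close>, where the \<open>w\<close> term dominates.\<close>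
  obtain \<epsilon> :: real where \<epsilon>: "\<epsilon> > 0" "\<And>K. K \<in> A \<Longrightarrow> eqn K v \<noteq> 0 \<Longrightarrow>
      \<epsilon> * (norm (eqn K w) + \<eta> * norm (eqn K u)) < norm (eqn K v)"
    using small_scale_exists [of "{K \<in> A. eqn K v \<noteq> 0}" "\<lambda>K. norm (eqn K v)"
        "\<lambda>K. norm (eqn K w) + \<eta> * norm (eqn K u)"] fin by auto
  define e where "e t = exp (2 * of_real pi * \<i> * complex_of_real t)" for t
  have e: "norm (e t) = 1" "e t \<noteq> 0" "e 0 = 1" "e 1 = 1" for t
    by (simp_all add: e_def norm_exp_eq_Re)
  have cont_e [continuous_intros]: "continuous_on S (\<lambda>x. e (f x))" if "continuous_on S f"
    for S :: "'b::topological_space set" and f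
    unfolding e_def using that by (intro continuous_intros)
  \<comment> \<open>The equation of \<open>K\<close> along the torus. Its leading term is the
    constant if \<open>K\<close> misses \<open>z\<close>, the \<open>w\<close> term if
    \<open>K\<close> passes through \<open>z\<close> and differs from \<open>H\<close>, and the
    \<open>u\<close> term if \<open>K = H\<close>.\<close>
  define \<phi> where "\<phi> K s t = eqn K v + \<epsilon> * e s * (eqn K w + \<eta> * e t * eqn K u)" for K s t
  define \<Theta>' where "\<Theta>' = (\<lambda>(s, t). v + (\<epsilon> * e s) *s (w + (\<eta> * e t) *s u))"
  define \<Theta> where "\<Theta> st = abs_cp2 (\<Theta>' st)" for st
  have eqn\<Theta>: "eqn K (\<Theta>' (s, t)) = \<phi> K s t" for K s t
    by (simp add: \<Theta>'_def \<phi>_def algebra_simps)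
  have small1: "norm (\<epsilon> * e s * (eqn K w + \<eta> * e t * eqn K u)) < norm (eqn K v)"
    if "K \<in> A" "eqn K v \<noteq> 0" for K s t
  proof -
    have "norm (eqn K w + \<eta> * e t * eqn K u) \<le> norm (eqn K w) + \<eta> * norm (eqn K u)"
      using \<eta>(1) norm_triangle_ineq [of "eqn K w" "\<eta> * e t * eqn K u"] by (simp add: norm_mult e)
    then have "norm (\<epsilon> * e s * (eqn K w + \<eta> * e t * eqn K u)) \<le> \<epsilon> * (norm (eqn K w) + \<eta> * norm (eqn K u))"
      using \<epsilon>(1) by (simp add: norm_mult e mult_left_mono)
    then show ?thesis
      using \<epsilon>(2) [OF that] by linarith
  qed
  have small2: "norm (\<eta> * e t * eqn K u) < norm (eqn K w)" if "K \<in> A" "K \<noteq> H" "eqn K v = 0" for K t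
    using \<eta>(2) [OF that(1) wK [OF that]] \<eta>(1) by (simp add: norm_mult e)
  have add_nz: "a + b \<noteq> 0" if "norm b < norm a" for a b :: complex
    using that by (metis add.inverse_inverse add_eq_0_iff less_irrefl norm_minus_cancel)
  have vH: "eqn H v = 0"
    using z zK [OF H] by simp
  have \<phi>nz: "\<phi> K s t \<noteq> 0" if K: "K \<in> A" for K s t
  proof (cases "eqn K v = 0")
    case False
    then show ?thesis
      unfolding \<phi>_def by (intro add_nz small1 K)
  next
    case True
    show ?thesis
    proof (cases "K = H")
      case True
      then show ?thesis
        using vH w(2) u e \<epsilon> \<eta> by (simp add: \<phi>_def)
    next
      case False
      then show ?thesis
        using add_nz [OF small2 [OF K False True]] True e \<epsilon>(1) by (simp add: \<phi>_def)
    qed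
  qed
  have \<Theta>M: "\<Theta>' st \<noteq> 0" "\<Theta> st \<in> ?M" for st
    using abs_cp2_in_complement [OF A, of "\<Theta>' st"] \<phi>nz eqn\<Theta> unfolding \<Theta>_def by (metis surj_pair)+
  have "continuous_on UNIV (\<lambda>st. v + (\<epsilon> * e (fst st)) *s (w + (\<eta> * e (snd st)) *s u))"
  proof -
    have "continuous_on UNIV (\<lambda>st. \<chi> i. v $ i + (\<epsilon> * e (fst st)) * (w $ i + (\<eta> * e (snd st)) * u $ i))"
      by (intro continuous_intros)
    then show ?thesis
      by (simp add: plus_vec_def vector_scalar_mult_def)
  qed
  then have "continuous_on UNIV \<Theta>'"
    by (simp add: \<Theta>'_def case_prod_unfold)
  then have "continuous_on UNIV \<Theta>"
    unfolding \<Theta>_def using \<Theta>M(1) by (intro continuous_on_compose2 [OF continuous_on_abs_cp2]) auto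
  then have cont: "continuous_on ({0..1} \<times> {0..1}) \<Theta>"
    by (rule continuous_on_subset) auto
  define \<alpha> where "\<alpha> = (\<lambda>s. \<Theta> (s, 0))"
  define \<beta> where "\<beta> = (\<lambda>t. \<Theta> (0, t))"
  have loops: "\<alpha> \<in> loops_at ?M (\<Theta> (0, 0))" "\<beta> \<in> loops_at ?M (\<Theta> (0, 0))"
      "homotopic_paths ?M (\<alpha> +++ \<beta>) (\<beta> +++ \<alpha>)"
    unfolding \<alpha>_def \<beta>_def by (rule torus_loops_commute [OF cont]; use \<Theta>M in \<open>auto simp: \<Theta>_def \<Theta>'_def e\<close>)+
  have path\<phi>: "path (\<lambda>s. \<phi> K s 0)" "path (\<lambda>t. \<phi> K 0 t)" for K
    unfolding \<phi>_def path_def by (intro continuous_intros)+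
  have image\<phi>: "0 \<notin> path_image (\<lambda>s. \<phi> K s 0)" "0 \<notin> path_image (\<lambda>t. \<phi> K 0 t)" if "K \<in> A" for K
    using \<phi>nz [OF that] by (auto simp: path_image_def)
  have wn_e: "winding_number (\<lambda>t. c * e t) 0 = 1" if "c \<noteq> 0" for c
  proof -
    have "path e" "0 \<notin> path_image e"
      using e(2) cont_e [OF continuous_on_id, of "{0..1}"] by (auto simp: path_def path_image_def)
    from winding_number_scale [OF this that] winding_number_unit_circle show ?thesis
      by (simp add: e_def [abs_def])
  qed
  have wn\<alpha>: "winding_number (\<lambda>s. \<phi> K s 0) 0 = of_bool (z \<in> K)" if K: "K \<in> A" for K
  proof (cases "eqn K v = 0")
    case True
    define c where "c = \<epsilon> * (eqn K w + \<eta> * e 0 * eqn K u)"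
    have "\<phi> K s 0 = c * e s" for s
      by (simp add: \<phi>_def c_def True)
    moreover from this [of 0] have "c \<noteq> 0"
      using \<phi>nz [OF K, of 0 0] by auto
    ultimately show ?thesis
      using True zK [OF K] by (simp add: wn_e)
  next
    case False
    have "winding_number (\<lambda>s. eqn K v + \<epsilon> * e s * (eqn K w + \<eta> * e 0 * eqn K u)) 0 = 0"
      by (intro winding_number_small_perturbation small1 K False)
        (auto simp: path_def pathstart_def pathfinish_def e intro!: continuous_intros)
    then show ?thesis
      using False zK [OF K] by (simp add: \<phi>_def)
  qed
  have wn\<beta>: "winding_number (\<lambda>t. \<phi> K 0 t) 0 = of_bool (K = H)" if K: "K \<in> A" for K
  proof (cases "eqn K v = 0")
    case False
    have "winding_number (\<lambda>t. eqn K v + \<epsilon> * e 0 * (eqn K w + \<eta> * e t * eqn K u)) 0 = 0"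
      by (intro winding_number_small_perturbation small1 K False)
        (auto simp: path_def pathstart_def pathfinish_def e intro!: continuous_intros)
    then show ?thesis
      using False vH by (auto simp: \<phi>_def)
  next
    case True
    show ?thesis
    proof (cases "K = H")
      case True
      have "\<phi> K 0 t = (\<epsilon> * \<eta> * eqn H u) * e t" for t
        using vH w(2) True by (simp add: \<phi>_def e)
      then show ?thesis
        using True u \<epsilon>(1) \<eta>(1) by (simp add: wn_e)
    next
      case False
      have p: "path (\<lambda>t. \<eta> * e t * eqn K u)"
        unfolding path_def by (intro continuous_intros)
      have "winding_number (\<lambda>t. eqn K w + \<eta> * e t * eqn K u) 0 = 0"
        using p by (intro winding_number_small_perturbation small2 K False True)
          (auto simp: pathstart_def pathfinish_def e)
      moreover have "winding_number (\<lambda>t. \<epsilon> * (eqn K w + \<eta> * e t * eqn K u)) 0 =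
          winding_number (\<lambda>t. eqn K w + \<eta> * e t * eqn K u) 0"
        using \<epsilon>(1) add_nz [OF small2 [OF K False True]]
        by (intro winding_number_scale) (auto simp: path_def path_image_def intro!: continuous_intros)
      ultimately show ?thesis
        using False True by (simp add: \<phi>_def e)
    qed
  qed
  have ratio\<Theta>: "ratio K L (\<Theta> (s, t)) = \<phi> K s t / \<phi> L s t" for K L s t
    using ratio_abs_cp2 [OF \<Theta>M(1), of K L "(s, t)"] by (simp add: \<Theta>_def eqn\<Theta>)
  have wn: "winding_number (ratio K L \<circ> \<alpha>) 0 = of_bool (z \<in> K) - of_bool (z \<in> L)"
      "winding_number (ratio K L \<circ> \<beta>) 0 = of_bool (K = H) - of_bool (L = H)" if "K \<in> A" "L \<in> A" for K L
    using winding_number_divide [OF path\<phi>(1) image\<phi>(1) path\<phi>(1) image\<phi>(1), OF that]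
      winding_number_divide [OF path\<phi>(2) image\<phi>(2) path\<phi>(2) image\<phi>(2), OF that] that
    by (simp_all add: o_def \<alpha>_def \<beta>_def ratio\<Theta> wn\<alpha> wn\<beta>)
  obtain c where c: "path c" "path_image c \<subseteq> ?M" "pathstart c = x" "pathfinish c = \<Theta> (0, 0)"
    using arr_complement_path_connected [OF A x \<Theta>M(2)] by blast
  note loops' = loops [folded c(4)]
  show ?thesis
  proof
    show "path_class ?M (conj_loop c \<beta>) \<in> carrier (fundamental_group ?M x)"
        "path_class ?M (conj_loop c \<alpha>) \<in> carrier (fundamental_group ?M x)"
      using conj_loop_in_loops_at [OF c(1,2)] loops' c(3) by (auto simp: fundamental_group_carrier)
    show "path_class ?M (conj_loop c \<beta>) \<otimes>\<^bsub>fundamental_group ?M x\<^esub> path_class ?M (conj_loop c \<alpha>) =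
        path_class ?M (conj_loop c \<alpha>) \<otimes>\<^bsub>fundamental_group ?M x\<^esub> path_class ?M (conj_loop c \<beta>)"
      using conj_loop_commute [OF c(1,2) loops'] c(3) by simp
    fix K L assume "K \<in> A" "L \<in> A"
    then show "wind (ratio K L) (path_class ?M (conj_loop c \<beta>)) = of_bool (K = H) - of_bool (L = H)"
        "wind (ratio K L) (path_class ?M (conj_loop c \<alpha>)) = of_bool (z \<in> K) - of_bool (z \<in> L)"
      by (simp_all add: wind_conj_loop [OF ratio_continuous [OF A] c(1,2)] loops' wn)
  qed
qed

section \<open>Independence of the points of multiplicity at least three\<close>

text \<open>The winding homomorphisms transported to the concrete product of free groups, with just
  the properties used below, so that only algebra and incidence geometry remain.\<close>

locale arrangement_weights =
  fixes A :: "cp2 set set" and k :: nat and r :: "nat \<Rightarrow> nat"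
    and W :: "cp2 set \<Rightarrow> cp2 set \<Rightarrow> (nat \<Rightarrow> letter list) \<Rightarrow> complex"
  assumes arrangement: "line_arrangement A"
    and additive: "H \<in> A \<Longrightarrow> K \<in> A \<Longrightarrow> additive_on (free_product k r) (W H K)"
    and cocycle: "H \<in> A \<Longrightarrow> K \<in> A \<Longrightarrow> L \<in> A \<Longrightarrow> x \<in> carrier (free_product k r) \<Longrightarrow>
      W H L x = W H K x + W K L x"
    and pencil: "H \<in> A \<Longrightarrow> K \<in> A \<Longrightarrow> L \<in> A \<Longrightarrow> H \<noteq> K \<Longrightarrow> K \<noteq> L \<Longrightarrow> L \<noteq> H \<Longrightarrow>
      p \<in> H \<Longrightarrow> p \<in> K \<Longrightarrow> p \<in> L \<Longrightarrow> x \<in> carrier (free_product k r) \<Longrightarrow> y \<in> carrier (free_product k r) \<Longrightarrow>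
      x \<otimes>\<^bsub>free_product k r\<^esub> y = y \<otimes>\<^bsub>free_product k r\<^esub> x \<Longrightarrow> W K H x * W L H y = W K H y * W L H x"
    and torus: "H \<in> A \<Longrightarrow> z \<in> H \<Longrightarrow>
      \<exists>x\<in>carrier (free_product k r). \<exists>y\<in>carrier (free_product k r).
        x \<otimes>\<^bsub>free_product k r\<^esub> y = y \<otimes>\<^bsub>free_product k r\<^esub> x \<and>
        (\<forall>K\<in>A. \<forall>L\<in>A. W K L x = of_bool (K = H) - of_bool (L = H) \<and>
          W K L y = of_bool (z \<in> K) - of_bool (z \<in> L))"
begin

abbreviation P where "P \<equiv> free_product k r"

lemma meridian:
  assumes "H \<in> A" "p \<in> H"
  obtains x where "x \<in> carrier P" "\<And>K L. K \<in> A \<Longrightarrow> L \<in> A \<Longrightarrow> W K L x = of_bool (K = H) - of_bool (L = H)"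
  using torus [OF assms] by blast

lemma three_lines:
  assumes "p \<in> VJY A"
  obtains H K L where "H \<in> A" "K \<in> A" "L \<in> A" "p \<in> H" "p \<in> K" "p \<in> L" "H \<noteq> K" "K \<noteq> L" "L \<noteq> H"
proof -
  have "3 \<le> card {H \<in> A. p \<in> H}"
    using assms by (simp add: VJY_def)
  then obtain T where T: "T \<subseteq> {H \<in> A. p \<in> H}" "card T = 3"
    by (rule obtain_subset_with_card_n)
  obtain H K L where "T = {H, K, L}" "H \<noteq> K" "H \<noteq> L" "K \<noteq> L"
    using T(2) unfolding card_3_iff by blast
  then show ?thesis
    using T(1) by (intro that [of H K L]) auto
qed

text \<open>The meridians of \<open>K\<close> and \<open>L\<close> have images (1, 0) and (0, 1)
  under \<open>(W K H, W L H)\<close>, so the pair is independent and the determinant condition puts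
  it on one factor.\<close>

lemma pencil_supported:
  assumes A: "H \<in> A" "K \<in> A" "L \<in> A" and ne: "H \<noteq> K" "K \<noteq> L" "L \<noteq> H" and p: "p \<in> H" "p \<in> K" "p \<in> L"
  shows "\<exists>i. supported_on k r i (W K H) \<and> supported_on k r i (W L H)"
proof -
  obtain x where x: "x \<in> carrier P" "\<And>H L. H \<in> A \<Longrightarrow> L \<in> A \<Longrightarrow> W H L x = of_bool (H = K) - of_bool (L = K)"
    using meridian [OF A(2) p(2)] by blast
  obtain y where y: "y \<in> carrier P" "\<And>H K. H \<in> A \<Longrightarrow> K \<in> A \<Longrightarrow> W H K y = of_bool (H = L) - of_bool (K = L)"
    using meridian [OF A(3) p(3)] by blast
  show ?thesis
  proof (rule commuting_det_imp_supported [OF additive additive _ x(1) y(1)])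
    show "W K H x * W L H y \<noteq> W K H y * W L H x"
      using A ne by (simp add: x y)
  qed (use A pencil [OF A ne p] in auto)
qed

text \<open>The pencils \<open>H\<close>, \<open>K\<close>, \<open>J\<close> for varying
  \<open>J\<close> all involve \<open>W K H\<close>, which is nonzero on a meridian of
  \<open>K\<close> and hence determines the factor. The remaining pairs are differences of
  homomorphisms relative to \<open>H\<close>.\<close>

lemma vertex_supported:
  assumes "p \<in> VJY A"
  shows "\<exists>i. \<forall>H\<in>A. \<forall>K\<in>A. p \<in> H \<longrightarrow> p \<in> K \<longrightarrow> supported_on k r i (W H K)"
proof -
  obtain H K L where A: "H \<in> A" "K \<in> A" "L \<in> A" and p: "p \<in> H" "p \<in> K" "p \<in> L"
    and ne: "H \<noteq> K" "K \<noteq> L" "L \<noteq> H"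
    using three_lines [OF assms] by metis
  obtain i where i: "supported_on k r i (W K H)"
    using pencil_supported [OF A ne p] by blast
  obtain x where x: "x \<in> carrier P" "\<And>H L. H \<in> A \<Longrightarrow> L \<in> A \<Longrightarrow> W H L x = of_bool (H = K) - of_bool (L = K)"
    using meridian [OF A(2) p(2)] by blast
  have base: "supported_on k r i (W J H)" if J: "J \<in> A" "p \<in> J" for J
  proof -
    consider "J = H" | "J = K" | "J \<noteq> H" "J \<noteq> K"
      by blast
    then show ?thesis
    proof cases
      case 1
      have "W H H y = 0" if "y \<in> carrier P" for y
        using cocycle [OF A(1,1,1) that] by simp
      then show ?thesis
        using factor_inj_carrier 1 by (simp add: supported_on_def)
    next
      case 2
      then show ?thesis
        using i by simp
    next
      case 3
      then obtain j where j: "supported_on k r j (W K H)" "supported_on k r j (W J H)"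
        using pencil_supported [of H K J p] A p J ne by blast
      then have "j = i"
        using supported_on_unique [OF additive [OF A(2,1)] j(1) i x(1)] x(2) [OF A(2,1)] ne by simp
      then show ?thesis
        using j by simp
    qed
  qed
  have "supported_on k r i (W I J)" if IJ: "I \<in> A" "J \<in> A" "p \<in> I" "p \<in> J" for I J
  proof -
    have "W I J x = W I H x - W J H x" if "x \<in> carrier P" for x
      using cocycle [OF IJ(1,2) A(1) that] by simp
    then show ?thesis
      using base [OF IJ(1,3)] base [OF IJ(2,4)] factor_inj_carrier [of _ r _ k] unfolding supported_on_def
      by simp
  qed
  then show ?thesis
    by blast
qed

text \<open>Two lines through \<open>p\<close> cannot both contain \<open>q\<close>. The second line
  \<open>H'\<close> is there as denominator: \<open>W H H'\<close> then belongs to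
  \<open>p\<close>.\<close>

lemma line_missing_point:
  assumes "p \<in> VJY A" "p \<noteq> q"
  obtains H H' where "H \<in> A" "H' \<in> A" "p \<in> H" "p \<in> H'" "H \<noteq> H'" "q \<notin> H"
proof -
  obtain H K L where A: "H \<in> A" "K \<in> A" "L \<in> A" and p: "p \<in> H" "p \<in> K" "p \<in> L"
    and ne: "H \<noteq> K" "K \<noteq> L" "L \<noteq> H"
    using three_lines [OF assms(1)] by metis
  have "is_line H" "is_line K"
    using A arrangement by (auto simp: line_arrangement_def)
  then have "q \<notin> H \<or> q \<notin> K"
    using lines_through_two_points_eq [of H K p q] p assms(2) ne by blast
  then show ?thesis
    using that A p ne by metis
qed

text \<open>If two vertices shared a factor, the torus at the intersection point of a line through one of
  them with a line through the other would give commuting elements of a free group with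
  independent images in its abelianization.\<close>

lemma vertex_factor_inj:
  assumes p: "p \<in> VJY A" and q: "q \<in> VJY A" and "p \<noteq> q"
    and ip: "\<forall>H\<in>A. \<forall>K\<in>A. p \<in> H \<longrightarrow> p \<in> K \<longrightarrow> supported_on k r i (W H K)"
    and iq: "\<forall>H\<in>A. \<forall>K\<in>A. q \<in> H \<longrightarrow> q \<in> K \<longrightarrow> supported_on k r j (W H K)"
  shows "i \<noteq> j"
proof
  assume "i = j"
  obtain H H' where H: "H \<in> A" "H' \<in> A" "p \<in> H" "p \<in> H'" "H \<noteq> H'" "q \<notin> H"
    using line_missing_point [OF p \<open>p \<noteq> q\<close>] .
  obtain K K' where K: "K \<in> A" "K' \<in> A" "q \<in> K" "q \<in> K'" "K \<noteq> K'" "p \<notin> K"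
    using line_missing_point [OF q \<open>p \<noteq> q\<close> [symmetric]] .
  have line: "is_line J" if "J \<in> A" for J
    using that arrangement by (auto simp: line_arrangement_def)
  obtain z where z: "z \<in> H" "z \<in> K"
    using lines_meet line H(1) K(1) by blast
  \<comment> \<open>Otherwise \<open>z = p\<close>, the only common point of \<open>H\<close> and
    \<open>H'\<close>, but \<open>p\<close> is not on \<open>K\<close>.\<close>
  have "z \<notin> H'"
    using lines_through_two_points_eq [of H H' p z] line H K z by metis
  moreover have "z \<notin> K'"
    using lines_through_two_points_eq [of K K' q z] line H K z by metis
  moreover have "K \<noteq> H" "K' \<noteq> H"
    using H K by auto
  moreover obtain x y where xy: "x \<in> carrier P" "y \<in> carrier P" "x \<otimes>\<^bsub>P\<^esub> y = y \<otimes>\<^bsub>P\<^esub> x"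
      "\<forall>I\<in>A. \<forall>J\<in>A. W I J x = of_bool (I = H) - of_bool (J = H) \<and>
        W I J y = of_bool (z \<in> I) - of_bool (z \<in> J)"
    using torus [OF H(1) z(1)] by blast
  \<comment> \<open>By the torus values the left side is 1 times 1 and the right side 1 times
    0.\<close>
  moreover have "W H H' x * W K K' y = W H H' y * W K K' x"
  proof (rule supported_on_det [OF _ _ _ _ xy(1-3)])
    show "supported_on k r i (W H H')" "supported_on k r i (W K K')"
      using ip iq H K \<open>i = j\<close> by auto
  qed (use additive H K in auto)
  ultimately show False
    using H K z by simp
qed

section \<open>Closed paths in the graph\<close>

lemma edge_line:
  assumes "(v, w) \<in> EJY A"
  shows "proj_span {v, w} \<in> A" "v \<in> proj_span {v, w}" "w \<in> proj_span {v, w}" "v \<noteq> w"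
    "v \<in> VJY A" "w \<in> VJY A"
proof -
  have "a \<in> proj_span S" if "a \<in> S" for a S
    unfolding proj_span_def
    by (rule image_eqI [of _ _ "rep_cp2 a"]) (use that in \<open>auto intro: vec.span_base\<close>)
  then show "v \<in> proj_span {v, w}" "w \<in> proj_span {v, w}"
    by auto
qed (use assms in \<open>auto simp: EJY_def\<close>)

text \<open>Evaluates the vanishing sum at one element \<open>y\<close> of the factor belonging to
  \<open>p 1\<close>. All terms of other vertices vanish there, while the turn at \<open>p 1\<close>
  makes the term of \<open>p 1\<close> equal to 1.\<close>

lemma no_closed_path:
  fixes p :: "nat \<Rightarrow> cp2"
  assumes d: "d \<ge> 2" and closed: "p d = p 0" and inj: "inj_on p {..<d}"
    and edge: "\<And>m. m < d \<Longrightarrow> (p m, p (Suc m)) \<in> EJY A"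
    and turn: "\<not> on_common_line {p 0, p 1, p 2}"
  shows False
proof -
  define L where "L m = proj_span {p m, p (Suc m)}" for m
  have L: "L m \<in> A" "p m \<in> L m" "p (Suc m) \<in> L m" "p m \<in> VJY A" if "m < d" for m
    unfolding L_def using edge_line [OF edge [OF that]] by auto
  have "L 1 \<noteq> L 0"
  proof
    assume "L 1 = L 0"
    moreover have "p 0 \<in> L 0" "p 1 \<in> L 0" "p 2 \<in> L 1"
      using L(2,3) [of 0] L(3) [of 1] d by (simp_all add: numeral_2_eq_2)
    moreover have "is_line (L 0)"
      using L(1) [of 0] arrangement d by (simp add: line_arrangement_def)
    ultimately show False
      using turn by (auto simp: on_common_line_def)
  qed
  have "\<forall>q\<in>VJY A. \<exists>i. \<forall>H\<in>A. \<forall>K\<in>A. q \<in> H \<longrightarrow> q \<in> K \<longrightarrow> supported_on k r i (W H K)"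
    using vertex_supported by blast
  then obtain f where f: "\<And>q. q \<in> VJY A \<Longrightarrow> \<forall>H\<in>A. \<forall>K\<in>A. q \<in> H \<longrightarrow> q \<in> K \<longrightarrow> supported_on k r (f q) (W H K)"
    by (metis bchoice)
  have sup: "supported_on k r (f (p m)) (W H K)" if "m < d" "H \<in> A" "K \<in> A" "p m \<in> H" "p m \<in> K" for m H K
    using f [OF L(4) [OF that(1)]] that by blast
  have fne: "f (p m) \<noteq> f (p 1)" if "m < d" "m \<noteq> 1" for m
  proof -
    have "p m \<noteq> p 1"
      using inj_onD [OF inj, of m 1] that d by auto
    then show ?thesis
      using vertex_factor_inj f L(4) [OF that(1)] L(4) [of 1] d by auto
  qed
  have L01: "L 0 \<in> A" "L 1 \<in> A" "p 1 \<in> L 1"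
    using L d by auto
  obtain x where "x \<in> carrier P"
      "\<And>H K. H \<in> A \<Longrightarrow> K \<in> A \<Longrightarrow> W H K x = of_bool (H = L 1) - of_bool (K = L 1)"
    using meridian [OF L01(2,3)] by blast
  then have x: "x \<in> carrier P" "W (L 1) (L 0) x = 1"
    using L01 \<open>L 1 \<noteq> L 0\<close> by auto
  define i where "i = f (p 1)"
  \<comment> \<open>Keeping only coordinate \<open>i\<close> of the meridian of \<open>L 1\<close>
    kills the homomorphisms of other vertices and preserves the value of
    \<open>W (L 1) (L 0)\<close>.\<close>
  define y where "y = factor_inj k i (x i)"
  have s1: "supported_on k r i (W (L 1) (L 0))"
    unfolding i_def using L(1-3) [of 0] L(1-3) [of 1] d by (intro sup) auto
  have add1: "additive_on P (W (L 1) (L 0))"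
    using L(1) d by (intro additive) auto
  have "i < k" and y1: "W (L 1) (L 0) y = 1"
    using supported_on_eval [OF add1 s1 x(1)] x(2) by (auto simp: y_def split: if_splits)
  then have xi: "x i \<in> carrier (free_group (r i))"
    using x(1) by auto
  then have y: "y \<in> carrier P"
    unfolding y_def by (rule factor_inj_carrier)
  have zero: "W H K y = 0" if "m < d" "m \<noteq> 1" "H \<in> A" "K \<in> A" "p m \<in> H" "p m \<in> K" for m H K
    using sup [OF that(1,3-6)] fne [OF that(1,2)] \<open>i < k\<close> xi unfolding supported_on_def y_def i_def by auto
  have "W (L m) (L 0) y = 1" if "1 \<le> m" "m < d" for m
    using that
  proof (induction m rule: dec_induct)
    case base
    show ?case
      using y1 .
  next
    case (step m)
    have "W (L (Suc m)) (L 0) y = W (L (Suc m)) (L m) y + W (L m) (L 0) y"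
      using L(1) step y by (intro cocycle) auto
    moreover have "W (L (Suc m)) (L m) y = 0"
      using L(1-3) [of m] L(1-3) [of "Suc m"] step by (intro zero [of "Suc m"]) auto
    ultimately show ?case
      using step by simp
  qed
  then have "W (L (d - 1)) (L 0) y = 1"
    using d by simp
  \<comment> \<open>As \<open>p d = p 0\<close>, both lines pass through \<open>p 0\<close>, whose
    factor is not \<open>i\<close>.\<close>
  moreover have "W (L (d - 1)) (L 0) y = 0"
    using L(1-3) [of "d - 1"] L(1-3) [of 0] d closed by (intro zero [of 0]) auto
  ultimately show False
    by simp
qed

text \<open>A reduced circle may revisit vertices, so a shortest closed segment is cut out of it;
  minimality makes its vertices distinct. Its length \<open>d\<close> is not 1 because edges join
  distinct points, and \<open>d \<ge> 2\<close> keeps the turn after position \<open>i\<close>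
  inside the tuple.\<close>

lemma no_reduced_circle: "\<not> reduced_circle (JY_minus_stars A []) cs"
proof
  assume "reduced_circle (JY_minus_stars A []) cs"
  then have len: "length cs \<ge> 2" and hd: "hd cs = last cs"
    and edge: "\<And>i. i + 1 < length cs \<Longrightarrow> (cs ! i, cs ! (i + 1)) \<in> EJY A"
    and turn: "\<And>i. i + 2 < length cs \<Longrightarrow> \<not> on_common_line {cs ! i, cs ! (i + 1), cs ! (i + 2)}"
    by (auto simp: reduced_circle_def reduced_path_def JY_minus_stars_def)
  define Q where "Q d \<longleftrightarrow> 0 < d \<and> (\<exists>i. i + d < length cs \<and> cs ! i = cs ! (i + d))" for d
  have "cs \<noteq> []"
    using len by auto
  then have "Q (length cs - 1)"
    using len hd unfolding Q_def by (auto simp: hd_conv_nth last_conv_nth intro!: exI [of _ 0])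
  define d where "d = (LEAST d. Q d)"
  have Q: "Q d" and least: "\<And>e. e < d \<Longrightarrow> \<not> Q e"
    unfolding d_def using \<open>Q (length cs - 1)\<close> by (rule LeastI) (rule not_less_Least)
  obtain i where i: "0 < d" "i + d < length cs" "cs ! i = cs ! (i + d)"
    using Q unfolding Q_def by blast
  have "d \<noteq> 1"
    using edge_line(4) [OF edge, of i] i by auto
  then have "d \<ge> 2"
    using i by simp
  moreover have "inj_on (\<lambda>m. cs ! (i + m)) {..<d}"
  proof (rule linorder_inj_onI)
    fix m n assume mn: "m < n" "m \<in> {..<d}" "n \<in> {..<d}"
    show "cs ! (i + m) \<noteq> cs ! (i + n)"
    proof
      assume "cs ! (i + m) = cs ! (i + n)"
      then have "Q (n - m)"
        using mn i unfolding Q_def by (auto intro!: exI [of _ "i + m"])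
      then show False
        using least [of "n - m"] mn less_imp_diff_less [of n d m] by simp
    qed
  qed auto
  ultimately show False
    using i edge turn [of i]
    by (intro no_closed_path [of d "\<lambda>m. cs ! (i + m)"]) (auto simp: numeral_2_eq_2)
qed

end

theorem theorem3p3:
  fixes A :: "cp2 set set" and x\<^sub>0 :: cp2 and k :: nat and r :: "nat \<Rightarrow> nat"
  assumes "line_arrangement A"
    and "x\<^sub>0 \<in> arr_complement A"
    and "fundamental_group (arr_complement A) x\<^sub>0 \<cong> product_group {..<k} (\<lambda>i. free_group (r i))"
  shows "nice_arrangement A"
proof -
  let ?M = "arr_complement A" and ?P = "free_product k r"
  let ?G = "fundamental_group ?M x\<^sub>0"
  note A = assms(1) and x\<^sub>0 = assms(2)
  obtain h where h: "h \<in> iso ?G ?P"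
    using assms(3) by (auto simp: is_iso_def)
  define g where "g = inv_into (carrier ?G) h"
  have bij: "bij_betw h (carrier ?G) (carrier ?P)"
    and hmult: "\<And>X Y. X \<in> carrier ?G \<Longrightarrow> Y \<in> carrier ?G \<Longrightarrow> h (X \<otimes>\<^bsub>?G\<^esub> Y) = h X \<otimes>\<^bsub>?P\<^esub> h Y"
    using h by (auto simp: iso_def hom_def)
  have gh: "g (h X) = X" if "X \<in> carrier ?G" for X
    unfolding g_def using bij that by (simp add: bij_betw_def)
  have hcar: "h X \<in> carrier ?P" if "X \<in> carrier ?G" for X
    using bij that by (rule bij_betwE [THEN bspec])
  have "g \<in> iso ?P ?G"
    unfolding g_def using group.iso_set_sym [OF group_fundamental_group [OF x\<^sub>0] h] .
  then have gcar: "\<And>u. u \<in> carrier ?P \<Longrightarrow> g u \<in> carrier ?G"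
    and gmult: "\<And>u v. u \<in> carrier ?P \<Longrightarrow> v \<in> carrier ?P \<Longrightarrow> g (u \<otimes>\<^bsub>?P\<^esub> v) = g u \<otimes>\<^bsub>?G\<^esub> g v"
    unfolding iso_def hom_def by blast+
  \<comment> \<open>Homomorphisms are pulled back along the inverse \<open>g\<close>; the commuting
    elements of the tori are pushed forward by \<open>h\<close>.\<close>
  interpret arrangement_weights A k r "\<lambda>H K u. wind (ratio H K) (g u)"
  proof
    show "line_arrangement A"
      by (rule A)
    show "additive_on ?P (\<lambda>u. wind (ratio H K) (g u))" if "H \<in> A" "K \<in> A" for H K
      unfolding additive_on_def
      using additive_onD [OF additive_on_wind [OF ratio_continuous [OF A that]] gcar gcar] gmult by metis
    show "wind (ratio H L) (g u) = wind (ratio H K) (g u) + wind (ratio K L) (g u)"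
      if "H \<in> A" "K \<in> A" "L \<in> A" "u \<in> carrier ?P" for H K L u
      using wind_ratio_add [OF A that(1-3) gcar [OF that(4)]] .
    show "wind (ratio K H) (g u) * wind (ratio L H) (g v) = wind (ratio K H) (g v) * wind (ratio L H) (g u)"
      if "H \<in> A" "K \<in> A" "L \<in> A" "H \<noteq> K" "K \<noteq> L" "L \<noteq> H" "p \<in> H" "p \<in> K" "p \<in> L"
        and u: "u \<in> carrier ?P" and v: "v \<in> carrier ?P" and uv: "u \<otimes>\<^bsub>?P\<^esub> v = v \<otimes>\<^bsub>?P\<^esub> u" for H K L p u v
    proof -
      have "g u \<otimes>\<^bsub>?G\<^esub> g v = g v \<otimes>\<^bsub>?G\<^esub> g u"
        using gmult u v uv by metis
      then show ?thesis
        by (rule wind_ratio_pencil_det [OF A that(1-9) x\<^sub>0 gcar [OF u] gcar [OF v]])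
    qed
    fix H z assume "H \<in> A" "z \<in> H"
    then obtain X Y where XY: "X \<in> carrier ?G" "Y \<in> carrier ?G" "X \<otimes>\<^bsub>?G\<^esub> Y = Y \<otimes>\<^bsub>?G\<^esub> X"
      "\<And>K L. K \<in> A \<Longrightarrow> L \<in> A \<Longrightarrow> wind (ratio K L) X = of_bool (K = H) - of_bool (L = H)"
      "\<And>K L. K \<in> A \<Longrightarrow> L \<in> A \<Longrightarrow> wind (ratio K L) Y = of_bool (z \<in> K) - of_bool (z \<in> L)"
      using torus_at_point [OF A _ _ x\<^sub>0] by metis
    have "h X \<otimes>\<^bsub>?P\<^esub> h Y = h Y \<otimes>\<^bsub>?P\<^esub> h X"
      using hmult XY(1-3) by metis
    then show "\<exists>u\<in>carrier ?P. \<exists>v\<in>carrier ?P. u \<otimes>\<^bsub>?P\<^esub> v = v \<otimes>\<^bsub>?P\<^esub> u \<and>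
        (\<forall>K\<in>A. \<forall>L\<in>A. wind (ratio K L) (g u) = of_bool (K = H) - of_bool (L = H) \<and>
          wind (ratio K L) (g v) = of_bool (z \<in> K) - of_bool (z \<in> L))"
      using XY gh hcar by (intro bexI [of _ "h X"] bexI [of _ "h Y"]) (auto simp del: mult_product_group)
  qed
  show ?thesis
    unfolding nice_arrangement_def
    by (rule exI [of _ "[]"]) (use no_reduced_circle in auto)
qed

end
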